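(* Let $G$ be a Polish group with metrizable universal minimal $G$-flow $M(G)$. Then $G$ is SUC-amenable.
   Context: A compact $G$-space is a compact Hausdorff space with a continuous left action of the topological group $G$; it is minimal if every orbit is dense, and $M(G)$ is the universal minimal compact $G$-flow (the unique up to isomorphism minimal compact $G$-flow having every minimal compact $G$-flow as a factor). A compact $G$-space $Y$, with its unique compatible uniformity $\mu_Y$, is SUC if for every $y_0\in Y$ and every $\varepsilon\in\mu_Y$ there is a neighborhood $U$ of $e$ such that $(guy_0,gy_0)\in\varepsilon$ for all $g\in G$, $u\in U$. An affine compact $G$-flow is a nonempty compact convex subset $Q$ of a locally convex Hausdorff real vector space with a continuous action of $G$ such that every translation $x\mapsto gx$ is affine. $G$ is SUC-amenable if every affine compact $G$-flow which is SUC (as a compact $G$-space) has a $G$-fixed point. *)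

theory Defs
  imports "HOL-Analysis.Analysis"
begin

section \<open>Compact flows\<close>

text \<open>
  Topological groups are types of class \<open>topological_group_add\<close>, the library's class of
  (not necessarily commutative) topological groups: the product of \<open>g\<close> and \<open>h\<close> is written
  \<open>g + h\<close> and the identity is \<open>0\<close>.  The space acted on is an abstract topology, so that
  spaces on arbitrary carrier sets can be quantified over; the values of the action outside
  \<open>topspace X\<close> are irrelevant.
\<close>

locale compact_G_space =
  fixes X :: "'x topology" and act :: "'g::topological_group_add \<Rightarrow> 'x \<Rightarrow> 'x"
  assumes compact: "compact_space X"
    and Hausdorff: "Hausdorff_space X"
    and continuous_act:
      "continuous_map (prod_topology (euclidean :: 'g topology) X) X (\<lambda>(g, x). act g x)"
    and act_zero: "x \<in> topspace X \<Longrightarrow> act 0 x = x"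
    and act_add: "x \<in> topspace X \<Longrightarrow> act (g + h) x = act g (act h x)"

text \<open>
  Minimal flows are nonempty; otherwise the empty flow would be minimal and no universal
  minimal flow could exist.
\<close>

locale minimal_G_space = compact_G_space +
  assumes nonempty: "topspace X \<noteq> {}"
    and dense_orbit: "x \<in> topspace X \<Longrightarrow> X closure_of (range (\<lambda>g. act g x)) = topspace X"

definition is_factor ::
    "'x topology \<Rightarrow> ('g \<Rightarrow> 'x \<Rightarrow> 'x) \<Rightarrow> 'y topology \<Rightarrow> ('g \<Rightarrow> 'y \<Rightarrow> 'y) \<Rightarrow> bool"
  where "is_factor X act Y act' \<longleftrightarrow>
    (\<exists>f. continuous_map X Y f \<and> f ` topspace X = topspace Y \<and>
         (\<forall>g. \<forall>x\<in>topspace X. f (act g x) = act' g (f x)))"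

text \<open>
  A quantifier in a definition cannot range over types, so the carriers of the minimal flows
  are taken in \<open>'g set set\<close>.  This loses nothing: the theorem \<open>universal_minimal_flow_factor\<close>
  below shows that every minimal flow on every type is then a factor.
\<close>

definition universal_minimal_flow ::
    "'m topology \<Rightarrow> ('g::topological_group_add \<Rightarrow> 'm \<Rightarrow> 'm) \<Rightarrow> bool"
  where "universal_minimal_flow M act \<longleftrightarrow> minimal_G_space M act \<and>
    (\<forall>(Y :: 'g set set topology) act'. minimal_G_space Y act' \<longrightarrow> is_factor M act Y act')"


section \<open>The uniformity of a compact Hausdorff space and SUC flows\<close>

text \<open>
  Uniformities are given as filters, with the axioms of the library class \<open>uniform_space\<close>
  relativised to \<open>topspace X\<close>; the entourages are the sets \<open>{p. E p}\<close> with
  \<open>eventually E \<mu>\<close>.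
\<close>

definition compatible_uniformity :: "'x topology \<Rightarrow> ('x \<times> 'x) filter \<Rightarrow> bool"
  where "compatible_uniformity X \<mu> \<longleftrightarrow>
    \<mu> \<le> principal (topspace X \<times> topspace X) \<and>
    (\<forall>E. eventually E \<mu> \<longrightarrow> (\<forall>x\<in>topspace X. E (x, x))) \<and>
    (\<forall>E. eventually E \<mu> \<longrightarrow> (\<forall>\<^sub>F (x, y) in \<mu>. E (y, x))) \<and>
    (\<forall>E. eventually E \<mu> \<longrightarrow>
       (\<exists>D. eventually D \<mu> \<and> (\<forall>x y z. D (x, y) \<longrightarrow> D (y, z) \<longrightarrow> E (x, z)))) \<and>
    (\<forall>U. openin X U \<longleftrightarrow>
       U \<subseteq> topspace X \<and> (\<forall>x\<in>U. \<forall>\<^sub>F (x', y) in \<mu>. x' = x \<longrightarrow> y \<in> U))"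

text \<open>
  Meaningful for compact Hausdorff spaces, see \<open>ex1_compatible_uniformity\<close> below.
\<close>

definition uniformity_of :: "'x topology \<Rightarrow> ('x \<times> 'x) filter"
  where "uniformity_of X = (THE \<mu>. compatible_uniformity X \<mu>)"

definition SUC :: "'x topology \<Rightarrow> ('g::topological_group_add \<Rightarrow> 'x \<Rightarrow> 'x) \<Rightarrow> bool"
  where "SUC Y act \<longleftrightarrow>
    (\<forall>y\<^sub>0\<in>topspace Y. \<forall>E. eventually E (uniformity_of Y) \<longrightarrow>
       (\<forall>\<^sub>F u in nhds 0. \<forall>g. E (act (g + u) y\<^sub>0, act g y\<^sub>0)))"


section \<open>Affine flows and SUC-amenability\<close>

text \<open>
  The constant \<open>convex\<close> cannot be used inside the class declaration, so its
  definition is written out there.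
\<close>

class locally_convex_space = real_vector + topological_ab_group_add + t2_space +
  assumes tendsto_scaleR_nhds:
      "LIM p (nhds c \<times>\<^sub>F nhds x). fst p *\<^sub>R snd p :> nhds (c *\<^sub>R x)"
    and ex_open_convex_nhd:
      "open U \<Longrightarrow> 0 \<in> U \<Longrightarrow> \<exists>V. open V \<and>
         (\<forall>x\<in>V. \<forall>y\<in>V. \<forall>u\<ge>0. \<forall>v\<ge>0. u + v = 1 \<longrightarrow> u *\<^sub>R x + v *\<^sub>R y \<in> V) \<and>
         0 \<in> V \<and> V \<subseteq> U"

lemma locally_convex:
  fixes U :: "'v::locally_convex_space set"
  assumes "open U" "0 \<in> U"
  shows "\<exists>V. open V \<and> convex V \<and> 0 \<in> V \<and> V \<subseteq> U"
proof -
  obtain V where "open V" "0 \<in> V" "V \<subseteq> U"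
    "\<forall>x\<in>V. \<forall>y\<in>V. \<forall>u\<ge>0. \<forall>v\<ge>0. u + v = 1 \<longrightarrow> u *\<^sub>R x + v *\<^sub>R y \<in> V"
    using ex_open_convex_nhd[OF assms] by blast
  then show ?thesis by (intro exI[of _ V] conjI convexI) auto
qed

instance real_normed_vector \<subseteq> locally_convex_space
proof
  fix c :: real and x :: 'a
  show "LIM p (nhds c \<times>\<^sub>F nhds x). fst p *\<^sub>R snd p :> nhds (c *\<^sub>R x)"
    by (intro tendsto_scaleR filterlim_fst filterlim_snd)
next
  fix U :: "'a set"
  assume "open U" "0 \<in> U"
  then obtain e where "e > 0" "ball 0 e \<subseteq> U"
    by (meson openE)
  then show "\<exists>V. open V \<and>
         (\<forall>x\<in>V. \<forall>y\<in>V. \<forall>u\<ge>0. \<forall>v\<ge>0. u + v = 1 \<longrightarrow> u *\<^sub>R x + v *\<^sub>R y \<in> V) \<and>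
         0 \<in> V \<and> V \<subseteq> U"
    using convexD[OF convex_ball[of 0 e]] by (intro exI[of _ "ball 0 e"]) auto
qed

definition affine_compact_flow ::
    "'v::locally_convex_space set \<Rightarrow> ('g::topological_group_add \<Rightarrow> 'v \<Rightarrow> 'v) \<Rightarrow> bool"
  where "affine_compact_flow Q act \<longleftrightarrow>
    Q \<noteq> {} \<and> compact Q \<and> convex Q \<and> compact_G_space (top_of_set Q) act \<and>
    (\<forall>g. \<forall>x\<in>Q. \<forall>y\<in>Q. \<forall>t\<in>{0..1}.
       act g ((1 - t) *\<^sub>R x + t *\<^sub>R y) = (1 - t) *\<^sub>R act g x + t *\<^sub>R act g y)"

text \<open>
  SUC-amenability of \<open>'g\<close> is \<open>SUC_amenable TYPE('g) TYPE('v)\<close> for all types \<open>'v\<close>, that is,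
  with \<open>'v\<close> a type variable that is left free in the theorem.
\<close>

definition SUC_amenable :: "'g::topological_group_add itself \<Rightarrow> 'v::locally_convex_space itself \<Rightarrow> bool"
  where "SUC_amenable _ _ \<longleftrightarrow>
    (\<forall>(Q :: 'v set) (act :: 'g \<Rightarrow> 'v \<Rightarrow> 'v).
       affine_compact_flow Q act \<longrightarrow> SUC (top_of_set Q) act \<longrightarrow> (\<exists>q\<in>Q. \<forall>g. act g q = q))"


section \<open>The definitions are adequate\<close>

subsection \<open>Existence and uniqueness of the compatible uniformity\<close>

definition diagonal_nhds :: "'x topology \<Rightarrow> ('x \<times> 'x) filter"
  where "diagonal_nhds X = (INF W \<in> {W. openin (prod_topology X X) W \<and> (\<forall>x\<in>topspace X. (x, x) \<in> W)}. principal W)"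

lemma eventually_diagonal_nhds:
  "eventually E (diagonal_nhds X) \<longleftrightarrow>
     (\<exists>W. openin (prod_topology X X) W \<and> (\<forall>x\<in>topspace X. (x, x) \<in> W) \<and> (\<forall>p\<in>W. E p))"
proof -
  let ?B = "{W. openin (prod_topology X X) W \<and> (\<forall>x\<in>topspace X. (x, x) \<in> W)}"
  have "openin (prod_topology X X) (topspace X \<times> topspace X)"
    using openin_topspace[of "prod_topology X X"] by simp
  then have "topspace X \<times> topspace X \<in> ?B" by simp
  then have "?B \<noteq> {}" by blast
  moreover have "\<exists>W\<in>?B. principal W \<le> inf (principal A) (principal B)" if "A \<in> ?B" "B \<in> ?B" for A B
    using that by (intro bexI[of _ "A \<inter> B"]) auto
  ultimately show ?thesis
    unfolding diagonal_nhds_def by (subst eventually_INF_base) (auto simp: eventually_principal)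
qed

lemma compatible_uniformity_diagonal_nhds:
  assumes "compact_space X" "Hausdorff_space X"
  shows "compatible_uniformity X (diagonal_nhds X)"
  unfolding compatible_uniformity_def
proof (intro conjI allI impI ballI)
  have "openin (prod_topology X X) (topspace X \<times> topspace X)"
    using openin_topspace[of "prod_topology X X"] by simp
  then show "diagonal_nhds X \<le> principal (topspace X \<times> topspace X)"
    by (auto simp: le_principal eventually_diagonal_nhds)
next
  fix E x assume "eventually E (diagonal_nhds X)" "x \<in> topspace X"
  then show "E (x, x)" by (auto simp: eventually_diagonal_nhds)
next
  fix E assume "eventually E (diagonal_nhds X)"
  then obtain W where W: "openin (prod_topology X X) W" "\<forall>x\<in>topspace X. (x, x) \<in> W" "\<forall>p\<in>W. E p"
    by (auto simp: eventually_diagonal_nhds)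
  define V where "V = {p \<in> topspace (prod_topology X X). (\<lambda>(x, y). (y, x)) p \<in> W}"
  have "continuous_map (prod_topology X X) (prod_topology X X) (\<lambda>(x, y). (y, x))"
    by (simp add: case_prod_unfold continuous_map_pairwise o_def continuous_map_fst continuous_map_snd)
  then have "openin (prod_topology X X) V"
    unfolding V_def using W(1) by (rule openin_continuous_map_preimage)
  moreover have "\<forall>x\<in>topspace X. (x, x) \<in> V" "\<forall>p\<in>V. (\<lambda>(x, y). E (y, x)) p"
    using W by (auto simp: V_def)
  ultimately show "\<forall>\<^sub>F (x, y) in diagonal_nhds X. E (y, x)"
    unfolding eventually_diagonal_nhds by blast
next
  fix E assume "eventually E (diagonal_nhds X)"
  then obtain W where W: "openin (prod_topology X X) W" "\<forall>x\<in>topspace X. (x, x) \<in> W" "\<forall>p\<in>W. E p"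
    by (auto simp: eventually_diagonal_nhds)
  have reg: "regular_space X"
    using assms compact_Hausdorff_imp_regular_space by blast
  have "\<exists>A B C. openin X A \<and> A \<times> A \<subseteq> W \<and> openin X B \<and> x \<in> B \<and> closedin X C \<and> B \<subseteq> C \<and> C \<subseteq> A"
    if x: "x \<in> topspace X" for x
  proof -
    obtain A1 A2 where "openin X A1" "openin X A2" "x \<in> A1" "x \<in> A2" "A1 \<times> A2 \<subseteq> W"
      using W x unfolding openin_prod_topology_alt by meson
    then have A: "openin X (A1 \<inter> A2)" "x \<in> A1 \<inter> A2" "(A1 \<inter> A2) \<times> (A1 \<inter> A2) \<subseteq> W"
      by auto
    obtain B C where "openin X B" "closedin X C" "x \<in> B" "B \<subseteq> C" "C \<subseteq> A1 \<inter> A2"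
      using reg A(1,2) unfolding neighbourhood_base_of_closedin[symmetric] neighbourhood_base_of
      by meson
    with A show ?thesis by blast
  qed
  then obtain A B C where ABC:
    "\<And>x. x \<in> topspace X \<Longrightarrow> openin X (A x) \<and> A x \<times> A x \<subseteq> W \<and> openin X (B x) \<and> x \<in> B x \<and>
       closedin X (C x) \<and> B x \<subseteq> C x \<and> C x \<subseteq> A x"
    by metis
  have "topspace X \<subseteq> \<Union> (B ` topspace X)" using ABC by blast
  then obtain F where F: "finite F" "F \<subseteq> B ` topspace X" "topspace X \<subseteq> \<Union> F"
    using assms(1)[unfolded compact_space_alt, rule_format, of "B ` topspace X"] ABC by (auto 4 4)
  then obtain S where S: "finite S" "S \<subseteq> topspace X" "F = B ` S"
    by (meson finite_subset_image)
  define V where "V = topspace (prod_topology X X) \<inter>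
     (\<Inter>s\<in>S. A s \<times> A s \<union> (topspace X - C s) \<times> (topspace X - C s))"
  have "openin (prod_topology X X) (A s \<times> A s \<union> (topspace X - C s) \<times> (topspace X - C s))"
    if "s \<in> S" for s
  proof -
    have "openin X (A s)" "openin X (topspace X - C s)"
      using ABC S that by auto
    then show ?thesis by (intro openin_Un) (simp_all add: openin_prod_Times_iff)
  qed
  then have V1: "openin (prod_topology X X) V"
    unfolding V_def using S(1)
    by (cases "S = {}") (auto simp del: topspace_prod_topology intro!: openin_Int openin_Inter)
  have V2: "\<forall>x\<in>topspace X. (x, x) \<in> V"
    using ABC S unfolding V_def by auto
  have V3: "E (x, z)" if "(x, y) \<in> V" "(y, z) \<in> V" for x y z
  proof -
    have "y \<in> topspace X" using that by (auto simp: V_def)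
    then obtain s where s: "s \<in> S" "y \<in> B s" using F S by blast
    have "y \<in> C s" using ABC S s by blast
    then have "x \<in> A s" "z \<in> A s" using that s unfolding V_def by auto
    then show ?thesis using ABC S s W(3) by blast
  qed
  show "\<exists>D. eventually D (diagonal_nhds X) \<and> (\<forall>x y z. D (x, y) \<longrightarrow> D (y, z) \<longrightarrow> E (x, z))"
    using V1 V2 V3 unfolding eventually_diagonal_nhds by (intro exI[of _ "\<lambda>p. p \<in> V"]) blast
next
  fix U
  show "openin X U \<longleftrightarrow>
    U \<subseteq> topspace X \<and> (\<forall>x\<in>U. \<forall>\<^sub>F (x', y) in diagonal_nhds X. x' = x \<longrightarrow> y \<in> U)"
  proof (intro iffI conjI ballI)
    assume U: "openin X U"
    then show "U \<subseteq> topspace X" by (rule openin_subset)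
    fix x assume x: "x \<in> U"
    let ?W = "U \<times> U \<union> (topspace X - {x}) \<times> topspace X"
    have "closedin X {x}"
      using assms(2) x \<open>U \<subseteq> topspace X\<close> by (simp add: closedin_Hausdorff_singleton subset_iff)
    then have "openin (prod_topology X X) ?W"
      using U by (intro openin_Un) (simp_all add: openin_prod_Times_iff openin_diff)
    then show "\<forall>\<^sub>F (x', y) in diagonal_nhds X. x' = x \<longrightarrow> y \<in> U"
      using x unfolding eventually_diagonal_nhds by (intro exI[of _ ?W]) auto
  next
    assume R: "U \<subseteq> topspace X \<and> (\<forall>x\<in>U. \<forall>\<^sub>F (x', y) in diagonal_nhds X. x' = x \<longrightarrow> y \<in> U)"
    show "openin X U"
    proof (subst openin_subopen, intro ballI)
      fix x assume x: "x \<in> U"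
      then obtain W where W: "openin (prod_topology X X) W" "\<forall>x\<in>topspace X. (x, x) \<in> W"
        "\<forall>p\<in>W. (\<lambda>(x', y). x' = x \<longrightarrow> y \<in> U) p"
        using R unfolding eventually_diagonal_nhds by blast
      then have "(x, x) \<in> W" using x R by blast
      then obtain A B where "openin X A" "openin X B" "x \<in> A" "x \<in> B" "A \<times> B \<subseteq> W"
        using W(1) unfolding openin_prod_topology_alt by meson
      then show "\<exists>T. openin X T \<and> x \<in> T \<and> T \<subseteq> U"
        using W(3) by (intro exI[of _ B]) auto
    qed
  qed
qed

lemma compatible_uniformity_nhd:
  assumes \<mu>: "compatible_uniformity X \<mu>" and E: "eventually E \<mu>" and x: "x \<in> topspace X"
  obtains U where "openin X U" "x \<in> U" "\<And>y. y \<in> U \<Longrightarrow> E (x, y)"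
proof -
  have comp: "\<And>E. eventually E \<mu> \<Longrightarrow>
      \<exists>D. eventually D \<mu> \<and> (\<forall>x y z. D (x, y) \<longrightarrow> D (y, z) \<longrightarrow> E (x, z))"
    using \<mu> unfolding compatible_uniformity_def by blast
  let ?N = "\<lambda>P z. \<forall>\<^sub>F (x', y) in \<mu>. x' = z \<longrightarrow> P y"
  define U where "U = {z \<in> topspace X. ?N (\<lambda>y. E (x, y)) z}"
  have "?N (\<lambda>y. y \<in> U) z" if z: "z \<in> U" for z
  proof -
    have "eventually (\<lambda>(x', y). x' = z \<longrightarrow> E (x, y)) \<mu>" using z by (simp add: U_def)
    with comp have "\<exists>D. eventually D \<mu> \<and> (\<forall>a b c. D (a, b) \<longrightarrow> D (b, c) \<longrightarrow>
        (\<lambda>(x', y). x' = z \<longrightarrow> E (x, y)) (a, c))"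
      by blast
    then obtain D where D: "eventually D \<mu>"
      "\<And>a b c. D (a, b) \<Longrightarrow> D (b, c) \<Longrightarrow> a = z \<longrightarrow> E (x, c)"
      by auto
    have top: "\<forall>\<^sub>F p in \<mu>. p \<in> topspace X \<times> topspace X"
      using \<mu> by (simp add: compatible_uniformity_def le_principal)
    show ?thesis
    proof (rule eventually_mono[OF eventually_conj[OF D(1) top]], clarify)
      fix z' y assume "D (z, y)" "y \<in> topspace X"
      moreover have "?N (\<lambda>w. E (x, w)) y"
        by (rule eventually_mono[OF D(1)]) (use D(2) \<open>D (z, y)\<close> in auto)
      ultimately show "y \<in> U" by (simp add: U_def)
    qed
  qed
  then have "openin X U"
    using \<mu> unfolding compatible_uniformity_def by (auto simp: U_def)
  moreover have "x \<in> U"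
    using x E by (auto simp: U_def elim: eventually_mono)
  moreover have "E (x, y)" if y: "y \<in> U" for y
  proof -
    have "?N (\<lambda>w. E (x, w)) y" "y \<in> topspace X" using y by (auto simp: U_def)
    then have "(\<lambda>(x', w). x' = y \<longrightarrow> E (x, w)) (y, y)"
      using \<mu> unfolding compatible_uniformity_def by blast
    then show ?thesis by simp
  qed
  ultimately show thesis by (rule that)
qed

lemma compatible_uniformity_unique:
  assumes X: "compact_space X" and \<mu>: "compatible_uniformity X \<mu>"
  shows "\<mu> = diagonal_nhds X"
proof (rule filter_eq_iff[THEN iffD2], intro allI iffI)
  have sym: "\<And>E. eventually E \<mu> \<Longrightarrow> \<forall>\<^sub>F (x, y) in \<mu>. E (y, x)"
    using \<mu> by (simp add: compatible_uniformity_def)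
  have comp: "\<And>E. eventually E \<mu> \<Longrightarrow>
      \<exists>D. eventually D \<mu> \<and> (\<forall>x y z. D (x, y) \<longrightarrow> D (y, z) \<longrightarrow> E (x, z))"
    using \<mu> by (simp add: compatible_uniformity_def)
  have top: "\<forall>\<^sub>F p in \<mu>. p \<in> topspace X \<times> topspace X"
    using \<mu> by (simp add: compatible_uniformity_def le_principal)
  have "\<forall>U. openin X U \<longleftrightarrow>
       U \<subseteq> topspace X \<and> (\<forall>x\<in>U. \<forall>\<^sub>F (x', y) in \<mu>. x' = x \<longrightarrow> y \<in> U)"
    using \<mu> unfolding compatible_uniformity_def by (elim conjE)
  then have opn: "\<And>U x. openin X U \<Longrightarrow> x \<in> U \<Longrightarrow> \<forall>\<^sub>F (x', y) in \<mu>. x' = x \<longrightarrow> y \<in> U"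
    by simp
  fix E
  {
    assume E: "eventually E \<mu>"
    obtain D where D: "eventually D \<mu>" "\<And>x y z. D (x, y) \<Longrightarrow> D (y, z) \<Longrightarrow> E (x, z)"
      using comp[OF E] by blast
    let ?D = "\<lambda>p. D p \<and> (\<lambda>(x, y). D (y, x)) p"
    have D': "eventually ?D \<mu>"
      using D(1) sym[OF D(1)] by (rule eventually_conj)
    have "\<exists>U. openin X U \<and> x \<in> U \<and> (\<forall>y\<in>U. ?D (x, y))" if "x \<in> topspace X" for x
      using compatible_uniformity_nhd[OF \<mu> D' that] by metis
    then obtain U where U: "\<And>x. x \<in> topspace X \<Longrightarrow> openin X (U x) \<and> x \<in> U x \<and> (\<forall>y\<in>U x. ?D (x, y))"
      by metis
    have "openin (prod_topology X X) (\<Union>x\<in>topspace X. U x \<times> U x)"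
      using U by (intro openin_Union) (auto simp: openin_prod_Times_iff)
    moreover have "E p" if p: "p \<in> (\<Union>x\<in>topspace X. U x \<times> U x)" for p
    proof -
      obtain x a b where x: "x \<in> topspace X" and p': "p = (a, b)" "a \<in> U x" "b \<in> U x" using p by auto
      have "D (a, x)" "D (x, b)" using U[OF x] p' by auto
      then show "E p" using D(2) p' by auto
    qed
    ultimately show "eventually E (diagonal_nhds X)"
      unfolding eventually_diagonal_nhds using U by (intro exI[of _ "\<Union>x\<in>topspace X. U x \<times> U x"]) blast
  next
    assume "eventually E (diagonal_nhds X)"
    then obtain W where W: "openin (prod_topology X X) W" "\<forall>x\<in>topspace X. (x, x) \<in> W" "\<forall>p\<in>W. E p"
      unfolding eventually_diagonal_nhds by blast
    have "\<exists>D V. eventually D \<mu> \<and> openin X V \<and> x \<in> V \<and> (\<forall>a b. a \<in> V \<longrightarrow> D (a, b) \<longrightarrow> E (a, b))"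
      if x: "x \<in> topspace X" for x
    proof -
      obtain A1 A2 where A: "openin X A1" "openin X A2" "x \<in> A1" "x \<in> A2" "A1 \<times> A2 \<subseteq> W"
        using W x unfolding openin_prod_topology_alt by meson
      have "\<forall>\<^sub>F (x', y) in \<mu>. x' = x \<longrightarrow> y \<in> A2" using opn A by blast
      from comp[OF this] obtain D where D: "eventually D \<mu>"
        "\<And>y z. D (x, y) \<Longrightarrow> D (y, z) \<Longrightarrow> z \<in> A2" by auto
      obtain V where V: "openin X V" "x \<in> V" "\<And>y. y \<in> V \<Longrightarrow> D (x, y)"
        using compatible_uniformity_nhd[OF \<mu> D(1) x] by metis
      have "openin X (V \<inter> A1)" "x \<in> V \<inter> A1" using V A by auto
      moreover have "E (a, b)" if "a \<in> V \<inter> A1" "D (a, b)" for a b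
        using that V(3) D(2) A(5) W(3) by blast
      ultimately show ?thesis using D(1) by blast
    qed
    then obtain D V where DV: "\<And>x. x \<in> topspace X \<Longrightarrow> eventually (D x) \<mu> \<and> openin X (V x) \<and> x \<in> V x \<and>
        (\<forall>a b. a \<in> V x \<longrightarrow> D x (a, b) \<longrightarrow> E (a, b))"
      by metis
    have "topspace X \<subseteq> \<Union> (V ` topspace X)" using DV by blast
    then obtain F where F: "finite F" "F \<subseteq> V ` topspace X" "topspace X \<subseteq> \<Union> F"
      using X[unfolded compact_space_alt, rule_format, of "V ` topspace X"] DV by (auto 4 4)
    then obtain S where S: "finite S" "S \<subseteq> topspace X" "F = V ` S"
      by (meson finite_subset_image)
    have "\<forall>\<^sub>F p in \<mu>. \<forall>s\<in>S. D s p"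
      using S DV by (intro eventually_ball_finite) auto
    from eventually_conj[OF this top] show "eventually E \<mu>"
    proof (rule eventually_mono, clarify)
      fix a b assume "\<forall>s\<in>S. D s (a, b)" "a \<in> topspace X"
      moreover then obtain s where "s \<in> S" "a \<in> V s" using F S by blast
      ultimately show "E (a, b)" using DV S by blast
    qed
  }
qed

theorem ex1_compatible_uniformity:
  assumes "compact_space X" "Hausdorff_space X"
  shows "\<exists>!\<mu>. compatible_uniformity X \<mu>"
  using compatible_uniformity_diagonal_nhds[OF assms] compatible_uniformity_unique[OF assms(1)]
  by blast


subsection \<open>Every minimal flow is isomorphic to one carried by sets of sets of group elements\<close>

context minimal_G_space
begin

lemma act_closed: "x \<in> topspace X \<Longrightarrow> act g x \<in> topspace X"
  using continuous_map_funspace[OF continuous_act] by (auto simp: Pi_iff)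

definition orbit_trace :: "'a \<Rightarrow> 'a \<Rightarrow> 'b set set"
  where "orbit_trace x\<^sub>0 x = {{g. act g x\<^sub>0 \<in> U} | U. openin X U \<and> x \<in> U}"

lemma inj_on_orbit_trace:
  assumes x0: "x\<^sub>0 \<in> topspace X"
  shows "inj_on (orbit_trace x\<^sub>0) (topspace X)"
proof (rule inj_onI, rule ccontr)
  fix y z assume yz: "y \<in> topspace X" "z \<in> topspace X" "orbit_trace x\<^sub>0 y = orbit_trace x\<^sub>0 z" "y \<noteq> z"
  then obtain U V where UV: "openin X U" "openin X V" "y \<in> U" "z \<in> V" "disjnt U V"
    using Hausdorff[unfolded Hausdorff_space_def, rule_format, of y z] by blast
  have "{g. act g x\<^sub>0 \<in> U} \<in> orbit_trace x\<^sub>0 z"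
    unfolding yz(3)[symmetric] using UV(1,3) by (auto simp: orbit_trace_def)
  then obtain U' where U': "openin X U'" "z \<in> U'" "{g. act g x\<^sub>0 \<in> U} = {g. act g x\<^sub>0 \<in> U'}"
    by (auto simp: orbit_trace_def)
  have "z \<in> X closure_of (range (\<lambda>g. act g x\<^sub>0))"
    using dense_orbit[OF x0] yz(2) by simp
  moreover have "openin X (U' \<inter> V)" "z \<in> U' \<inter> V" using U' UV by auto
  ultimately obtain g where "act g x\<^sub>0 \<in> U' \<inter> V"
    unfolding in_closure_of by blast
  then show False using U'(3) UV(5) by (auto simp: disjnt_def)
qed

end

theorem universal_minimal_flow_factor:
  fixes M :: "'m topology" and act :: "'g::topological_group_add \<Rightarrow> 'm \<Rightarrow> 'm"
    and Y :: "'y topology" and act' :: "'g \<Rightarrow> 'y \<Rightarrow> 'y"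
  assumes M: "universal_minimal_flow M act" and Y: "minimal_G_space Y act'"
  shows "is_factor M act Y act'"
proof -
  interpret Y: minimal_G_space Y act' by (rule Y)
  obtain y0 where y0: "y0 \<in> topspace Y" using Y.nonempty by blast
  define c where "c = Y.orbit_trace y0"
  define d where "d = inv_into (topspace Y) c"
  define Z where "Z = pullback_topology (c ` topspace Y) d Y"
  define b where "b = (\<lambda>g z. c (act' g (d z)))"
  have inj: "inj_on c (topspace Y)" unfolding c_def by (rule Y.inj_on_orbit_trace[OF y0])
  have dc: "d (c y) = y" if "y \<in> topspace Y" for y
    using that inj by (simp add: d_def)
  have topZ: "topspace Z = c ` topspace Y"
    unfolding Z_def topspace_pullback_topology using dc by auto
  have cd: "c (d z) = z" "d z \<in> topspace Y" if "z \<in> topspace Z" for z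
    using that dc unfolding topZ by auto
  have cont_d: "continuous_map Z Y d"
    unfolding Z_def using continuous_map_pullback[OF continuous_map_id] by fastforce
  have cont_c: "continuous_map Y Z c"
    unfolding Z_def
  proof (rule continuous_map_pullback')
    show "continuous_map Y Y (d \<circ> c)"
      using dc by (intro continuous_map_eq[OF continuous_map_id]) auto
    show "topspace Y \<subseteq> c -` c ` topspace Y" by auto
  qed
  have hom: "homeomorphic_maps Y Z c d"
    unfolding homeomorphic_maps_def using cont_c cont_d dc cd by auto
  then have hs: "Y homeomorphic_space Z" unfolding homeomorphic_space_def by blast
  have cZ: "c y \<in> topspace Z" if "y \<in> topspace Y" for y using that topZ by blast
  have "minimal_G_space Z b"
  proof
    show "compact_space Z" using hs Y.compact homeomorphic_compact_space by blast
    show "Hausdorff_space Z" using hs Y.Hausdorff homeomorphic_Hausdorff_space by blast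
    have "continuous_map (prod_topology euclidean Z) (prod_topology euclidean Y) (\<lambda>p. (fst p, d (snd p)))"
      by (simp add: continuous_map_pairwise o_def continuous_map_fst
          continuous_map_compose[OF continuous_map_snd cont_d, unfolded o_def])
    from continuous_map_compose[OF continuous_map_compose[OF this Y.continuous_act] cont_c]
    show "continuous_map (prod_topology euclidean Z) Z (\<lambda>(g, z). b g z)"
      by (simp add: b_def o_def case_prod_unfold)
    show "b 0 z = z" if "z \<in> topspace Z" for z
      using that cd by (simp add: b_def Y.act_zero)
    show "b (g + h) z = b g (b h z)" if "z \<in> topspace Z" for g h z
      using that cd by (simp add: b_def Y.act_add dc Y.act_closed)
    show "topspace Z \<noteq> {}" using topZ y0 by auto
    show "Z closure_of range (\<lambda>g. b g z) = topspace Z" if z: "z \<in> topspace Z" for z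
    proof -
      have hm: "homeomorphic_map Y Z c" using hom homeomorphic_maps_map by blast
      have "range (\<lambda>g. act' g (d z)) \<subseteq> topspace Y" using cd[OF z] Y.act_closed by blast
      from homeomorphic_map_closure_of[OF hm this]
      have "Z closure_of (c ` range (\<lambda>g. act' g (d z))) = c ` topspace Y"
        using Y.dense_orbit[OF cd(2)[OF z]] by simp
      then show ?thesis by (simp add: b_def topZ image_image)
    qed
  qed
  then have "is_factor M act Z b" using M unfolding universal_minimal_flow_def by blast
  then obtain f where f: "continuous_map M Z f" "f ` topspace M = topspace Z"
    "\<And>g x. x \<in> topspace M \<Longrightarrow> f (act g x) = b g (f x)"
    by (auto simp only: is_factor_def)
  have "continuous_map M Y (d \<circ> f)" using f(1) cont_d by (rule continuous_map_compose)
  moreover have "(d \<circ> f) ` topspace M = topspace Y"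
    unfolding image_comp[symmetric] f(2) topZ using dc by (force simp: image_image)
  moreover have "(d \<circ> f) (act g x) = act' g ((d \<circ> f) x)" if x: "x \<in> topspace M" for g x
  proof -
    have "f x \<in> topspace Z" using x f(2) by blast
    then show ?thesis using f(3)[OF x] cd by (simp add: b_def dc Y.act_closed)
  qed
  ultimately show ?thesis unfolding is_factor_def by blast
qed

end

theory Submission
  imports Defs
begin

text \<open>
  Let \<open>Y\<close> be a minimal subflow of an affine SUC flow \<open>Q\<close>.  Since \<open>M\<close> is metrizable, \<open>Y\<close> is locally
  transitive in the sense of Rosendal: every nonempty open set contains a nonempty open \<open>W\<close> such
  that a given identity neighbourhood \<open>U\<close> links any two nonempty open subsets of \<open>W\<close>.  Failing this,
  \<open>Y\<close> would have infinitely many open sets pairwise separated by \<open>U\<close>, and \<open>M\<close> would contain a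
  sequence without convergent subsequences, much like a copy of the Stone-Cech compactification of
  the integers.  With Baire's theorem, SUC and local transitivity make the action on \<open>Y\<close>
  equicontinuous.  By Hall's marriage theorem \<open>Y\<close> then has nonempty finite subsets that each group
  element permutes up to a small error; their averages are almost fixed points in \<open>Q\<close>, and
  compactness yields a fixed point.
\<close>

section \<open>Hall's marriage theorem\<close>

text \<open>Induction on \<open>I\<close>, after Halmos and Vaughan. If some nonempty proper
  \<open>J\<close> is tight, with exactly \<open>card J\<close> candidates, then \<open>J\<close>
  and its complement are matched separately. Otherwise every nonempty proper subset has a candidate
  to spare, and any single choice can be made first.\<close>

lemma marriage:
  assumes "finite I" "\<And>i. i \<in> I \<Longrightarrow> finite (A i)"
    and "\<And>J. J \<subseteq> I \<Longrightarrow> card J \<le> card (\<Union>i\<in>J. A i)"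
  shows "\<exists>r. inj_on r I \<and> (\<forall>i\<in>I. r i \<in> A i)"
  using assms
proof (induction I arbitrary: A rule: finite_psubset_induct)
  case (psubset I)
  note fin = \<open>finite I\<close>
  show ?case
  proof (cases "\<exists>J. J \<subset> I \<and> J \<noteq> {} \<and> card (\<Union>i\<in>J. A i) = card J")
    case True
    then obtain J where J: "J \<subset> I" "J \<noteq> {}" "card (\<Union>i\<in>J. A i) = card J" by blast
    define N where "N = (\<Union>i\<in>J. A i)"
    have finJ: "finite J" using J(1) fin by (meson finite_subset psubset_imp_subset)
    have finN: "finite N" using J(1) finJ psubset.prems(1) by (auto simp: N_def)
    obtain r where r: "inj_on r J" "\<forall>i\<in>J. r i \<in> A i"
      using psubset.IH[of J A] J(1) psubset.prems by (meson order_trans psubset_imp_subset subsetD)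
    have "\<exists>r. inj_on r (I - J) \<and> (\<forall>i\<in>I - J. r i \<in> A i - N)"
    proof (rule psubset.IH)
      show "I - J \<subset> I" using J by blast
      show "finite (A i - N)" if "i \<in> I - J" for i using that psubset.prems(1) by simp
      fix L assume L: "L \<subseteq> I - J"
      have finL: "finite L" using L fin by (meson finite_Diff finite_subset)
      \<comment> \<open>Since \<open>J\<close> is tight, giving up its candidates \<open>N\<close>
        costs exactly \<open>card J\<close>, and the condition for \<open>J \<union> L\<close>
        leaves enough for \<open>L\<close>.\<close>
      have "card J + card L = card (J \<union> L)"
        using L finL finJ by (intro card_Un_disjoint[symmetric]) auto
      also have "\<dots> \<le> card (\<Union>i\<in>J \<union> L. A i)"
        using L J(1) by (intro psubset.prems(2)) auto
      also have "(\<Union>i\<in>J \<union> L. A i) = N \<union> (\<Union>i\<in>L. A i - N)" by (auto simp: N_def)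
      also have "card \<dots> \<le> card N + card (\<Union>i\<in>L. A i - N)" by (rule card_Un_le)
      finally show "card L \<le> card (\<Union>i\<in>L. A i - N)" using J(3) by (simp add: N_def)
    qed
    then obtain r' where r': "inj_on r' (I - J)" "\<forall>i\<in>I - J. r' i \<in> A i - N" by blast
    define q where "q i = (if i \<in> J then r i else r' i)" for i
    have "inj_on q (J \<union> (I - J))"
      unfolding inj_on_Un
    proof (intro conjI)
      show "inj_on q J" using r(1) by (simp add: q_def inj_on_def)
      show "inj_on q (I - J)" using r'(1) by (simp add: q_def inj_on_def)
      show "q ` (J - (I - J)) \<inter> q ` (I - J - J) = {}"
        using r(2) r'(2) by (fastforce simp: q_def N_def)
    qed
    moreover have "J \<union> (I - J) = I" using J(1) by blast
    moreover have "\<forall>i\<in>I. q i \<in> A i" using r(2) r'(2) by (simp add: q_def)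
    ultimately show ?thesis by auto
  next
    case False
    show ?thesis
    proof (cases "I = {}")
      case False
      then obtain a where a: "a \<in> I" by blast
      have "card {a} \<le> card (\<Union>i\<in>{a}. A i)" using a by (intro psubset.prems(2)) auto
      then obtain x where x: "x \<in> A a" by fastforce
      have "\<exists>r. inj_on r (I - {a}) \<and> (\<forall>i\<in>I - {a}. r i \<in> A i - {x})"
      proof (rule psubset.IH)
        show "I - {a} \<subset> I" using a by blast
        show "finite (A i - {x})" if "i \<in> I - {a}" for i using that psubset.prems(1) by simp
        fix L assume L: "L \<subseteq> I - {a}"
        show "card L \<le> card (\<Union>i\<in>L. A i - {x})"
        proof (cases "L = {}")
          case False
          have "L \<subset> I" using L a by blast
          \<comment> \<open>As \<open>L\<close> is not tight, its inequality is strict, which pays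
            for the loss of \<open>x\<close>.\<close>
          then have "card (\<Union>i\<in>L. A i) \<noteq> card L" using \<open>\<nexists>J. _\<close> False by blast
          moreover have "card L \<le> card (\<Union>i\<in>L. A i)"
            using \<open>L \<subset> I\<close> by (intro psubset.prems(2)) auto
          moreover have "card (\<Union>i\<in>L. A i) - 1 \<le> card ((\<Union>i\<in>L. A i) - {x})"
            by (simp add: card_Diff_singleton_if)
          moreover have "card ((\<Union>i\<in>L. A i) - {x}) = card (\<Union>i\<in>L. A i - {x})"
            by (rule arg_cong[of _ _ card]) blast
          ultimately show ?thesis by linarith
        qed simp
      qed
      then obtain r where r: "inj_on r (I - {a})" "\<forall>i\<in>I - {a}. r i \<in> A i - {x}" by blast
      have "inj_on (r(a := x)) (insert a (I - {a}))"
        using r by (subst inj_on_insert) (auto simp: inj_on_def)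
      moreover have "insert a (I - {a}) = I" using a by blast
      moreover have "\<forall>i\<in>I. (r(a := x)) i \<in> A i" using r(2) x by simp
      ultimately show ?thesis by auto
    qed simp
  qed
qed

section \<open>Gauges on topological groups\<close>

text \<open>Here \<open>x\<close> is the first entry at which the partial sums reach
  \<open>t\<close>, or the last entry if they never do. With \<open>t\<close> half of the total
  weight, the parts before and after \<open>x\<close> weigh at most \<open>t\<close> each.\<close>

lemma list_split_at_weight:
  fixes w :: "'a \<Rightarrow> real"
  assumes "xs \<noteq> []" "0 \<le> t"
  shows "\<exists>ys x zs. xs = ys @ x # zs \<and> sum_list (map w ys) \<le> t \<and>
    (zs = [] \<or> t \<le> sum_list (map w ys) + w x)"
  using assms
proof (induction xs arbitrary: t)
  case (Cons a xs)
  show ?case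
  proof (cases "xs = [] \<or> t \<le> w a")
    case True
    then show ?thesis using Cons.prems by (intro exI[of _ "[]"] exI[of _ a] exI[of _ xs]) auto
  next
    case False
    then obtain ys x zs where "xs = ys @ x # zs" "sum_list (map w ys) \<le> t - w a"
      "zs = [] \<or> t - w a \<le> sum_list (map w ys) + w x"
      using Cons.IH[of "t - w a"] by auto
    then show ?thesis by (intro exI[of _ "a # ys"] exI[of _ x] exI[of _ zs]) auto
  qed
qed simp

text \<open>Induction on the length. Splitting at half of the total weight leaves two parts lighter
  than \<open>(1/2) ^ Suc n\<close>, whose sums lie in \<open>B (Suc n)\<close> by induction. The
  entry between them lies there too, and \<open>step\<close> combines the three.\<close>

lemma sum_list_in_if_weight_less:
  fixes B :: "nat \<Rightarrow> 'g::group_add set" and xs :: "('g \<times> nat) list"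
  assumes zero: "\<And>k. 0 \<in> B k"
    and step: "\<And>k x y z. x \<in> B (Suc k) \<Longrightarrow> y \<in> B (Suc k) \<Longrightarrow> z \<in> B (Suc k) \<Longrightarrow> x + y + z \<in> B k"
    and "\<forall>(g, k)\<in>set xs. g \<in> B k"
    and "(\<Sum>(g, k)\<leftarrow>xs. (1/2) ^ k) < (1/2 :: real) ^ n"
  shows "sum_list (map fst xs) \<in> B n"
  using assms(3,4)
proof (induction "length xs" arbitrary: xs n rule: less_induct)
  case less
  define w where "w = (\<lambda>(g :: 'g, k). (1/2 :: real) ^ k)"
  have anti: "B j \<subseteq> B i" if "i \<le> j" for i j
    using that by (induction rule: dec_induct) (use step[OF _ zero zero] in auto)
  have w0: "0 \<le> sum_list (map w ys)" for ys
    by (intro sum_list_nonneg) (auto simp: w_def)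
  have wn: "sum_list (map w xs) < (1/2) ^ n"
    using less.prems(2) by (simp add: w_def)
  show ?case
  proof (cases "xs = []")
    case False
    define t where "t = sum_list (map w xs) / 2"
    have "0 \<le> t" using w0 by (simp add: t_def)
    obtain ys x zs where xs: "xs = ys @ x # zs" and ys: "sum_list (map w ys) \<le> t"
      and zs: "zs = [] \<or> t \<le> sum_list (map w ys) + w x"
      using list_split_at_weight[OF False \<open>0 \<le> t\<close>, of w] by auto
    have t2: "t < (1/2) ^ Suc n" using wn by (simp add: t_def)
    have sum: "sum_list (map w ys) + w x + sum_list (map w zs) = 2 * t"
      by (simp add: t_def xs)
    have "sum_list (map w zs) \<le> t" using zs sum \<open>0 \<le> t\<close> by auto
    then have "sum_list (map fst ys) \<in> B (Suc n)" "sum_list (map fst zs) \<in> B (Suc n)"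
      using ys t2 less.prems(1) xs by (intro less.hyps; simp add: w_def)+
    moreover have "fst x \<in> B (Suc n)"
    proof -
      \<comment> \<open>One entry weighs at most as much as the whole chain; weights being powers of
        1/2, its index exceeds \<open>n\<close>.\<close>
      have "w x < (1/2) ^ n" using sum w0[of ys] w0[of zs] t2 by simp
      then have "Suc n \<le> snd x"
        by (cases x) (simp add: w_def power_strict_decreasing_iff Suc_le_eq)
      then show ?thesis using anti less.prems(1) xs by (cases x) auto
    qed
    ultimately show ?thesis using step[of "sum_list (map fst ys)" n "fst x"] xs
      by (simp add: add.assoc)
  qed (simp add: zero)
qed

text \<open>
  The chain metrization argument of Birkhoff and Kakutani.  Starting the chain of neighbourhoods
  with \<open>UNIV\<close> makes every group element the sum of a chain.
\<close>

lemma group_gauge: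
  fixes U :: "'g::{topological_group_add, first_countable_topology} set"
  assumes "open U" "0 \<in> U"
  obtains N :: "'g \<Rightarrow> real" where
    "\<And>g h. N (g + h) \<le> N g + N h" "\<And>g. N (- g) = N g" "(N \<longlongrightarrow> 0) (nhds 0)" "\<And>g. 0 \<le> N g"
    "\<And>g. N g < 1 \<Longrightarrow> g \<in> U"
proof -
  define good where "good B \<longleftrightarrow> open B \<and> (0 :: 'g) \<in> B \<and> uminus ` B \<subseteq> B" for B
  have good_Int: "good (A \<inter> uminus -` A)" if "open A" "0 \<in> A" for A
  proof -
    have "open (uminus -` A)"
      using that(1) by (intro open_vimage continuous_on_minus continuous_on_id)
    then show ?thesis using that by (auto simp: good_def)
  qed
  \<comment> \<open>Dependent choice of symmetric open neighbourhoods of 0 whose threefold sums lie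
    in the preceding one; from index 1 on they lie in \<open>U\<close>.\<close>
  have "\<exists>B. \<forall>n. (good (B n) \<and> (n = 0 \<longrightarrow> B n = UNIV)) \<and> B (Suc n) \<subseteq> U \<and>
      (\<forall>x\<in>B (Suc n). \<forall>y\<in>B (Suc n). \<forall>z\<in>B (Suc n). x + y + z \<in> B n)"
  proof (rule dependent_nat_choice)
    show "\<exists>B. good B \<and> ((0 :: nat) = 0 \<longrightarrow> B = UNIV)"
      by (rule exI[of _ UNIV]) (auto simp: good_def)
    fix B and n :: nat
    assume "good B \<and> (n = 0 \<longrightarrow> B = UNIV)"
    then have "good B" by simp
    have "((\<lambda>p. fst p + fst (snd p) + snd (snd p)) \<longlongrightarrow> 0 + 0 + (0 :: 'g)) (nhds 0 \<times>\<^sub>F (nhds 0 \<times>\<^sub>F nhds 0))"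
      by (intro tendsto_intros filterlim_fst filterlim_compose[OF filterlim_fst filterlim_snd]
          filterlim_compose[OF filterlim_snd filterlim_snd])
    then have "\<forall>\<^sub>F p in nhds 0 \<times>\<^sub>F (nhds 0 \<times>\<^sub>F nhds 0). fst p + fst (snd p) + snd (snd p) \<in> B"
      using \<open>good B\<close> by (auto simp: good_def elim: topological_tendstoD)
    then obtain P Q1 Q2 where Q: "eventually P (nhds (0 :: 'g))" "eventually Q1 (nhds (0 :: 'g))"
      "eventually Q2 (nhds (0 :: 'g))" "\<And>x y z. P x \<Longrightarrow> Q1 y \<Longrightarrow> Q2 z \<Longrightarrow> x + y + z \<in> B"
      unfolding eventually_prod_filter by fastforce
    have "\<forall>\<^sub>F x in nhds 0. P x \<and> Q1 x \<and> Q2 x \<and> x \<in> U"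
      using Q(1-3) assms by (intro eventually_conj eventually_nhds_in_open)
    then obtain C where C: "open C" "0 \<in> C" "\<And>x. x \<in> C \<Longrightarrow> P x \<and> Q1 x \<and> Q2 x \<and> x \<in> U"
      unfolding eventually_nhds by blast
    then show "\<exists>B'. (good B' \<and> (Suc n = 0 \<longrightarrow> B' = UNIV)) \<and> B' \<subseteq> U \<and> (\<forall>x\<in>B'. \<forall>y\<in>B'. \<forall>z\<in>B'. x + y + z \<in> B)"
      using good_Int[OF C(1,2)] Q(4) by (intro exI[of _ "C \<inter> uminus -` C"]) auto
  qed
  then obtain B where B: "\<And>n. good (B n)" "B 0 = UNIV" "\<And>n. B (Suc n) \<subseteq> U"
    "\<And>n x y z. x \<in> B (Suc n) \<Longrightarrow> y \<in> B (Suc n) \<Longrightarrow> z \<in> B (Suc n) \<Longrightarrow> x + y + z \<in> B n"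
    by metis
  have B0: "0 \<in> B n" for n using B(1) by (simp add: good_def)
  define weight where "weight xs = (\<Sum>(g, k)\<leftarrow>xs. (1/2 :: real) ^ k)" for xs :: "('g \<times> nat) list"
  define chains where "chains g = {xs. (\<forall>(h, k)\<in>set xs. h \<in> B k) \<and> sum_list (map fst xs) = g}" for g
  \<comment> \<open>The infimal weight of a chain with sum \<open>g\<close>. Concatenating chains
    makes it subadditive, and a value below 1/2 puts \<open>g\<close> into \<open>B 1\<close>, hence
    into \<open>U\<close>.\<close>
  define L where "L g = Inf (weight ` chains g)" for g
  have w0: "0 \<le> weight xs" for xs
    unfolding weight_def by (intro sum_list_nonneg) auto
  have bdd: "bdd_below (weight ` chains g)" for g
    by (intro bdd_belowI[of _ 0]) (use w0 in auto)
  have ne: "chains g \<noteq> {}" for g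
  proof -
    have "[(g, 0)] \<in> chains g" by (simp add: chains_def B)
    then show ?thesis by blast
  qed
  have L_le: "L g \<le> weight xs" if "xs \<in> chains g" for g xs
    unfolding L_def using that bdd by (intro cInf_lower) auto
  have L0: "0 \<le> L g" for g
    unfolding L_def using ne w0 by (intro cInf_greatest) auto
  have L_add: "L (g + h) \<le> L g + L h" for g h
  proof -
    have "L (g + h) \<le> weight xs + weight ys" if "xs \<in> chains g" "ys \<in> chains h" for xs ys
      using L_le[of "xs @ ys" "g + h"] that by (auto simp: chains_def weight_def)
    then have "L (g + h) - weight ys \<le> L g" if "ys \<in> chains h" for ys
      unfolding L_def[of g] using ne that by (intro cInf_greatest) (auto simp: algebra_simps)
    then have "L (g + h) - L g \<le> L h"
      unfolding L_def[of h] using ne by (intro cInf_greatest) (auto simp: algebra_simps)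
    then show ?thesis by simp
  qed
  have L_small: "L g \<le> (1/2) ^ k" if "g \<in> B k" for g k
    using L_le[of "[(g, k)]" g] that by (simp add: chains_def weight_def)
  have L_U: "g \<in> U" if "L g < 1/2" for g
  proof -
    have "\<exists>x\<in>weight ` chains g. x < 1/2"
      using that cInf_lessD[of "weight ` chains g" "1/2"] ne unfolding L_def by blast
    then obtain xs where "xs \<in> chains g" "weight xs < (1/2) ^ 1" by auto
    then have "g \<in> B 1"
      using sum_list_in_if_weight_less[of B xs 1] B0 B(4)
      unfolding chains_def weight_def by blast
    then show ?thesis using B(3)[of 0] by auto
  qed
  \<comment> \<open>The maximum makes the gauge symmetric; the factor 2 moves the threshold from 1/2
    to 1.\<close>
  define N where "N g = 2 * max (L g) (L (- g))" for g
  show ?thesis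
  proof
    show "N (g + h) \<le> N g + N h" for g h
      using L_add[of g h] L_add[of "- h" "- g"] by (auto simp: N_def minus_add max_def)
    show "N (- g) = N g" for g by (simp add: N_def max.commute)
    show "0 \<le> N g" for g using L0[of g] by (simp add: N_def)
    show "g \<in> U" if "N g < 1" for g using L_U that by (simp add: N_def)
    show "(N \<longlongrightarrow> 0) (nhds 0)"
    proof (rule tendstoI)
      fix e :: real assume "0 < e"
      then obtain k where k: "(1/2) ^ k < e / 2"
        using real_arch_pow_inv[of "e / 2" "1/2"] by auto
      have "\<forall>\<^sub>F g in nhds 0. g \<in> B k"
        using B(1)[of k] by (intro eventually_nhds_in_open) (auto simp: good_def)
      then show "\<forall>\<^sub>F g in nhds 0. dist (N g) 0 < e"
      proof (rule eventually_mono)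
        fix g assume "g \<in> B k"
        moreover from this have "- g \<in> B k" using B(1)[of k] by (auto simp: good_def)
        ultimately have "L g < e / 2" "L (- g) < e / 2" using L_small k by fastforce+
        then show "dist (N g) 0 < e" using L0[of g] by (simp add: N_def dist_real_def)
      qed
    qed
  qed
qed

section \<open>Minimal flows\<close>

context compact_G_space
begin

lemma act_in_topspace: "x \<in> topspace X \<Longrightarrow> act g x \<in> topspace X"
  using continuous_map_funspace[OF continuous_act] by (auto simp: Pi_iff)

lemma act_uminus_act:
  assumes "x \<in> topspace X"
  shows "act (- g) (act g x) = x" "act g (act (- g) x) = x"
  using act_add[OF assms, of "- g" g] act_add[OF assms, of g "- g"] assms
  by (simp_all add: act_zero)

lemma continuous_map_act: "continuous_map X X (act g)"
proof -
  have "continuous_map X (prod_topology (euclidean :: 'g topology) X) (\<lambda>x. (g, x))"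
    by (intro continuous_map_pairedI) auto
  from continuous_map_compose[OF this continuous_act] show ?thesis
    by (simp add: o_def)
qed

lemma compact_G_space_subtopology:
  assumes "closedin X S" and "\<And>g x. x \<in> S \<Longrightarrow> act g x \<in> S"
  shows "compact_G_space (subtopology X S) act"
proof
  have S: "S \<subseteq> topspace X" using assms(1) by (rule closedin_subset)
  show "compact_space (subtopology X S)"
    using assms(1) compact by (simp add: closedin_compact_space compact_space_subtopology)
  show "Hausdorff_space (subtopology X S)" using Hausdorff by (rule Hausdorff_space_subtopology)
  have "continuous_map (prod_topology (euclidean :: 'g topology) (subtopology X S)) X (\<lambda>(g, x). act g x)"
    unfolding prod_topology_subtopology using continuous_act by (rule continuous_map_from_subtopology)
  then show "continuous_map (prod_topology (euclidean :: 'g topology) (subtopology X S)) (subtopology X S)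
      (\<lambda>(g, x). act g x)"
    using assms(2) by (auto simp: continuous_map_in_subtopology)
  show "act 0 x = x" if "x \<in> topspace (subtopology X S)" for x
    using that S by (simp add: act_zero)
  show "act (g + h) x = act g (act h x)" if "x \<in> topspace (subtopology X S)" for g h x
    using that S by (simp add: act_add)
qed

lemma act_closure_of:
  assumes "\<And>g x. x \<in> S \<Longrightarrow> act g x \<in> S" "x \<in> X closure_of S"
  shows "act g x \<in> X closure_of S"
proof -
  have "act g x \<in> X closure_of (act g ` S)"
    using continuous_map_image_closure_subset[OF continuous_map_act] assms(2) by blast
  moreover have "act g ` S \<subseteq> S" using assms(1) by blast
  ultimately show ?thesis using closure_of_mono by blast
qed

text \<open>Zorn's lemma applies to the closed invariant subsets of \<open>K\<close> by compactness.
  The closure of an orbit in a minimal such set is again closed and invariant, hence all of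
  it.\<close>

lemma ex_minimal_subflow:
  assumes K: "closedin X K" "K \<noteq> {}" "\<And>g x. x \<in> K \<Longrightarrow> act g x \<in> K"
  obtains Z where "closedin X Z" "Z \<subseteq> K" "Z \<noteq> {}" "minimal_G_space (subtopology X Z) act"
proof -
  \<comment> \<open>The complements of the nonempty closed invariant subsets of \<open>K\<close>, so
    that a minimal set becomes a maximal one.\<close>
  define \<A> where "\<A> = {A. openin X A \<and> topspace X - K \<subseteq> A \<and> A \<noteq> topspace X \<and>
    (\<forall>g. \<forall>x\<in>topspace X - A. act g x \<notin> A)}"
  have "K \<subseteq> topspace X" using K(1) by (rule closedin_subset)
  have compl: "topspace X - S \<in> \<A>"
    if "closedin X S" "S \<subseteq> K" "S \<noteq> {}" "\<And>g x. x \<in> S \<Longrightarrow> act g x \<in> S" for S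
    using that \<open>K \<subseteq> topspace X\<close> by (auto simp: \<A>_def)
  have "\<exists>A\<in>\<A>. \<forall>B\<in>\<A>. A \<subseteq> B \<longrightarrow> B = A"
  proof (rule subset_Zorn_nonempty)
    show "\<A> \<noteq> {}" using compl[OF K(1) order_refl K(2,3)] by blast
    fix \<C> assume \<C>: "\<C> \<noteq> {}" "subset.chain \<A> \<C>"
    then have sub: "\<C> \<subseteq> \<A>" by (simp add: subset.chain_def)
    have "\<Union> \<C> \<noteq> topspace X"
    proof
      assume "\<Union> \<C> = topspace X"
      then obtain \<F> where \<F>: "finite \<F>" "\<F> \<subseteq> \<C>" "topspace X \<subseteq> \<Union> \<F>"
        using compact[unfolded compact_space_alt, rule_format, of \<C>] sub by (auto simp: \<A>_def)
      \<comment> \<open>A finite nonempty part of a chain has a largest member. If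
        \<open>\<F>\<close> is empty, so is its union, and any member serves.\<close>
      obtain A where A: "A \<in> \<C>" "\<Union> \<F> \<subseteq> A"
      proof (cases "\<F> = {}")
        case True
        then show ?thesis using \<C>(1) that by auto
      next
        case False
        moreover have "subset.chain \<A> \<F>"
          using \<F>(2) \<C>(2) sub by (simp add: subset_chain_def subset_iff)
        ultimately have "\<Union> \<F> \<in> \<F>" using \<F>(1) by (intro Union_in_chain)
        then show ?thesis using that \<F>(2) by blast
      qed
      then have "A = topspace X"
        using \<F>(3) sub openin_subset[of X A] by (auto simp: \<A>_def)
      then show False using A sub by (auto simp: \<A>_def)
    qed
    moreover have "openin X (\<Union> \<C>)" using sub by (auto simp: \<A>_def)
    moreover have "topspace X - K \<subseteq> \<Union> \<C>" using sub \<C>(1) unfolding \<A>_def by blast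
    moreover have "act g x \<notin> A" if "x \<in> topspace X - \<Union> \<C>" "A \<in> \<C>" for g x A
      using that sub unfolding \<A>_def by blast
    ultimately show "\<Union> \<C> \<in> \<A>" unfolding \<A>_def by blast
  qed
  then obtain A where A: "A \<in> \<A>" "\<And>B. B \<in> \<A> \<Longrightarrow> A \<subseteq> B \<Longrightarrow> B = A" by blast
  define Z where "Z = topspace X - A"
  have Z: "closedin X Z" "Z \<subseteq> K" "Z \<noteq> {}" "Z \<subseteq> topspace X"
    using A(1) openin_subset[of X A] by (auto simp: Z_def \<A>_def)
  have inv: "act g x \<in> Z" if "x \<in> Z" for g x
    using that A(1) act_in_topspace by (auto simp: Z_def \<A>_def)
  interpret Z: compact_G_space "subtopology X Z" act
    by (rule compact_G_space_subtopology[OF Z(1) inv])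
  have "minimal_G_space (subtopology X Z) act"
  proof
    show "topspace (subtopology X Z) \<noteq> {}" using Z by auto
    fix x assume "x \<in> topspace (subtopology X Z)"
    then have x: "x \<in> Z" by simp
    define C where "C = X closure_of (range (\<lambda>g. act g x))"
    have orbit: "range (\<lambda>g. act g x) \<subseteq> Z" using inv x by blast
    have "C \<subseteq> Z" unfolding C_def using orbit Z(1) by (rule closure_of_minimal)
    have "topspace X - C \<in> \<A>"
    proof (rule compl)
      show "closedin X C" by (simp add: C_def)
      show "C \<subseteq> K" using \<open>C \<subseteq> Z\<close> Z by blast
      have "range (\<lambda>g. act g x) \<subseteq> C"
        unfolding C_def using orbit Z by (intro closure_of_subset) auto
      then show "C \<noteq> {}" by blast
      fix g y assume "y \<in> C"
      moreover have "act h z \<in> range (\<lambda>g. act g x)" if z: "z \<in> range (\<lambda>g. act g x)" for h z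
      proof -
        obtain k where "z = act k x" using z by blast
        then have "act h z = act (h + k) x" using x Z by (subst act_add) auto
        then show ?thesis by blast
      qed
      ultimately show "act g y \<in> C" unfolding C_def by (intro act_closure_of)
    qed
    moreover have "A \<subseteq> topspace X - C"
      using \<open>C \<subseteq> Z\<close> A(1) openin_subset[of X A] by (auto simp: Z_def \<A>_def)
    ultimately have "topspace X - C = A" using A(2) by blast
    moreover have "C \<subseteq> topspace X" by (simp add: C_def closure_of_subset_topspace)
    ultimately have "C = Z" by (auto simp: Z_def)
    then show "subtopology X Z closure_of (range (\<lambda>g. act g x)) = topspace (subtopology X Z)"
      using orbit Z by (simp add: C_def closure_of_subtopology Int_absorb1 Int_absorb2)
  qed
  with Z show thesis by (intro that)
qed

end

section \<open>Orbits, covers by translates, and uniform closeness from SUC\<close>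

context minimal_G_space
begin

lemma orbit_meets_open:
  assumes "x \<in> topspace X" "openin X U" "U \<noteq> {}"
  shows "\<exists>g. act g x \<in> U"
proof -
  obtain y where y: "y \<in> U" using assms(3) by blast
  then have "y \<in> X closure_of (range (\<lambda>g. act g x))"
    using dense_orbit[OF assms(1)] openin_subset[OF assms(2)] by blast
  then show ?thesis using assms(2) y by (auto simp: in_closure_of)
qed

lemma openin_act_preimage:
  assumes "openin X U"
  shows "openin X {x \<in> topspace X. act g x \<in> U}"
  using openin_continuous_map_preimage[OF continuous_map_act assms] .

text \<open>The condition \<open>act (- h) x \<in> W\<close> places \<open>x\<close> in the
  translate of \<open>W\<close> by \<open>h\<close>. Every orbit meets \<open>W\<close>, so these
  open translates cover the compact space.\<close>

lemma finite_translates_cover: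
  assumes "openin X W" "W \<noteq> {}"
  obtains F where "finite F" "\<And>x. x \<in> topspace X \<Longrightarrow> \<exists>h\<in>F. act (- h) x \<in> W"
proof -
  define P where "P h = {x \<in> topspace X. act (- h) x \<in> W}" for h
  have "\<exists>h. x \<in> P h" if x: "x \<in> topspace X" for x
  proof -
    obtain g where "act g x \<in> W" using orbit_meets_open[OF x assms] by blast
    then show ?thesis using x by (intro exI[of _ "- g"]) (simp add: P_def)
  qed
  then have "topspace X \<subseteq> \<Union> (range P)" by blast
  moreover have "openin X (P h)" for h
    unfolding P_def using assms(1) by (rule openin_act_preimage)
  ultimately obtain \<F> where \<F>: "finite \<F>" "\<F> \<subseteq> range P" "topspace X \<subseteq> \<Union> \<F>"
    using compact[unfolded compact_space_alt, rule_format, of "range P"] by auto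
  then obtain F where F: "finite F" "\<F> = P ` F" by (meson finite_subset_image)
  show thesis
  proof
    show "finite F" by (rule F)
    show "\<exists>h\<in>F. act (- h) x \<in> W" if "x \<in> topspace X" for x
      using \<F>(3) F(2) that by (auto simp: P_def)
  qed
qed

text \<open>
  Baire's theorem makes the neighbourhood \<open>B\<close> in the SUC condition uniform on an open set.  If
  \<open>u\<close> in \<open>B\<close> moves a point near \<open>y\<close> to a point near \<open>x\<close>, then no \<open>g\<close> can separate \<open>x\<close> from \<open>y\<close>.
\<close>

lemma ex_open_uniformly_close:
  fixes C :: "('a \<times> 'a) set"
  assumes first_countable: "first_countable (euclidean :: 'b topology)"
    and C: "closedin (prod_topology X X) C"
    and SUC: "\<And>y. y \<in> topspace X \<Longrightarrow> \<forall>\<^sub>F u in nhds 0. \<forall>g. (act (g + u) y, act g y) \<in> C"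
    and trans: "\<And>U V. open U \<Longrightarrow> 0 \<in> U \<Longrightarrow> openin X V \<Longrightarrow> V \<noteq> {} \<Longrightarrow>
      \<exists>W\<subseteq>V. openin X W \<and> W \<noteq> {} \<and>
        (\<forall>W1 W2. openin X W1 \<and> W1 \<subseteq> W \<and> W1 \<noteq> {} \<and> openin X W2 \<and> W2 \<subseteq> W \<and> W2 \<noteq> {} \<longrightarrow>
          (\<exists>u\<in>U. \<exists>y\<in>W1. act u y \<in> W2))"
  obtains W where "openin X W" "W \<noteq> {}" "\<And>x y g. x \<in> W \<Longrightarrow> y \<in> W \<Longrightarrow> (act g x, act g y) \<in> C"
proof -
  have "\<exists>\<B>. countable \<B> \<and> (\<forall>B\<in>\<B>. open B) \<and>
      (\<forall>U. open U \<and> (0 :: 'b) \<in> U \<longrightarrow> (\<exists>B\<in>\<B>. 0 \<in> B \<and> B \<subseteq> U))"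
    using first_countable by (simp add: first_countable_def)
  then obtain \<B> :: "'b set set" where \<B>: "countable \<B>" "\<And>B. B \<in> \<B> \<Longrightarrow> open B"
    "\<And>U. open U \<Longrightarrow> 0 \<in> U \<Longrightarrow> \<exists>B\<in>\<B>. 0 \<in> B \<and> B \<subseteq> U"
    by metis
  \<comment> \<open>The points at which \<open>B\<close> witnesses the SUC condition for
    \<open>C\<close>. These sets are closed because \<open>C\<close> is, and by SUC the countably
    many that come from \<open>\<B>\<close> cover the space.\<close>
  define A where "A B = {y \<in> topspace X. \<forall>u\<in>B. \<forall>g. (act (g + u) y, act g y) \<in> C}" for B
  have closedA: "closedin X (A B)" if "0 \<in> B" for B
  proof -
    have "closedin X {y \<in> topspace X. (act (g + u) y, act g y) \<in> C}" for g u
      by (intro closedin_continuous_map_preimage[OF _ C] continuous_map_pairedI continuous_map_act)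
    moreover have "A B = (\<Inter>(u, g)\<in>B \<times> UNIV. {y \<in> topspace X. (act (g + u) y, act g y) \<in> C})"
      using that by (auto simp: A_def)
    ultimately show ?thesis using that by (auto intro!: closedin_Inter)
  qed
  have cover: "\<Union> (A ` {B \<in> \<B>. 0 \<in> B}) = topspace X"
  proof
    show "\<Union> (A ` {B \<in> \<B>. 0 \<in> B}) \<subseteq> topspace X" by (auto simp: A_def)
    show "topspace X \<subseteq> \<Union> (A ` {B \<in> \<B>. 0 \<in> B})"
    proof
      fix y assume y: "y \<in> topspace X"
      then obtain U where "open U" "0 \<in> U" "\<And>u. u \<in> U \<Longrightarrow> \<forall>g. (act (g + u) y, act g y) \<in> C"
        using SUC[OF y] unfolding eventually_nhds by blast
      then show "y \<in> \<Union> (A ` {B \<in> \<B>. 0 \<in> B})"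
        using \<B>(3)[of U] y by (fastforce simp: A_def)
    qed
  qed
  \<comment> \<open>Baire's theorem: countably many closed sets without interior cannot cover a
    nonempty compact Hausdorff space.\<close>
  obtain B where B: "B \<in> \<B>" "0 \<in> B" "X interior_of (A B) \<noteq> {}"
  proof -
    have "X interior_of \<Union> (A ` {B \<in> \<B>. 0 \<in> B}) = {}"
      if "\<And>B. B \<in> \<B> \<Longrightarrow> 0 \<in> B \<Longrightarrow> X interior_of (A B) = {}"
    proof (rule Baire_category_alt)
      show "completely_metrizable_space X \<or> locally_compact_space X \<and> regular_space X"
        using compact Hausdorff
        by (simp add: compact_imp_locally_compact_space compact_Hausdorff_imp_regular_space)
      show "countable (A ` {B \<in> \<B>. 0 \<in> B})"
        using \<B>(1) by (intro countable_image) (rule countable_subset[of _ \<B>], auto)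
    qed (use that closedA in auto)
    then show ?thesis using that cover nonempty by auto
  qed
  obtain W where W: "W \<subseteq> X interior_of (A B)" "openin X W" "W \<noteq> {}"
    "\<And>W1 W2. openin X W1 \<Longrightarrow> W1 \<subseteq> W \<Longrightarrow> W1 \<noteq> {} \<Longrightarrow> openin X W2 \<Longrightarrow> W2 \<subseteq> W \<Longrightarrow> W2 \<noteq> {} \<Longrightarrow>
      \<exists>u\<in>B. \<exists>y\<in>W1. act u y \<in> W2"
    using trans[OF \<B>(2)[OF B(1)] B(2) openin_interior_of B(3)] by metis
  have WA: "W \<subseteq> A B" using W(1) interior_of_subset by fastforce
  have "(act g x, act g y) \<in> C" if xy: "x \<in> W" "y \<in> W" for x y g
  proof (rule ccontr)
    assume "(act g x, act g y) \<notin> C"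
    moreover have "act g x \<in> topspace X" "act g y \<in> topspace X"
      using xy WA act_in_topspace by (auto simp: A_def)
    ultimately have "(act g x, act g y) \<in> topspace (prod_topology X X) - C" by simp
    moreover have "openin (prod_topology X X) (topspace (prod_topology X X) - C)"
      using C by blast
    ultimately obtain O1 O2 where O: "openin X O1" "openin X O2" "act g x \<in> O1" "act g y \<in> O2"
      "O1 \<times> O2 \<subseteq> topspace (prod_topology X X) - C"
      unfolding openin_prod_topology_alt by meson
    \<comment> \<open>As \<open>C\<close> is closed, a failure at \<open>(act g x, act g y)\<close>
      persists on the box \<open>O1 \<times> O2\<close>. Linking \<open>W1\<close> to
      \<open>W2\<close> by \<open>u \<in> B\<close> puts some
      \<open>(act (g + u) z, act g z)\<close> into this box, although
      \<open>z \<in> A B\<close>.\<close>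
    define W1 where "W1 = W \<inter> {z \<in> topspace X. act g z \<in> O2}"
    define W2 where "W2 = W \<inter> {z \<in> topspace X. act g z \<in> O1}"
    have "W \<subseteq> topspace X" using W(2) by (rule openin_subset)
    then have "openin X W1" "W1 \<subseteq> W" "y \<in> W1" "openin X W2" "W2 \<subseteq> W" "x \<in> W2"
      unfolding W1_def W2_def using W(2) O xy by (auto intro!: openin_Int openin_act_preimage)
    then obtain u z where uz: "u \<in> B" "z \<in> W1" "act u z \<in> W2" using W(4)[of W1 W2] by blast
    have "z \<in> topspace X" using uz(2) by (simp add: W1_def)
    then have "act (g + u) z \<in> O1" "act g z \<in> O2" using uz by (auto simp: W1_def W2_def act_add)
    then have "(act (g + u) z, act g z) \<notin> C" using O(5) by blast
    moreover have "z \<in> A B" using uz(2) WA by (auto simp: W1_def)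
    ultimately show False using uz(1) by (simp add: A_def)
  qed
  with W(2,3) show thesis by (rule that)
qed

end

section \<open>Metrizability of the universal minimal flow\<close>

text \<open>Used to check joint continuity of the action on the function coordinates below, where
  the error is split into two halves.\<close>

lemma continuous_map_realI:
  assumes "\<And>x e. x \<in> topspace X \<Longrightarrow> 0 < e \<Longrightarrow>
    \<exists>U. openin X U \<and> x \<in> U \<and> (\<forall>y\<in>U. \<bar>f y - f x\<bar> < e)"
  shows "continuous_map X euclideanreal f"
  unfolding continuous_map_def
proof (intro conjI allI impI)
  fix V :: "real set" assume "openin euclidean V"
  then have V: "open V" by simp
  show "openin X {x \<in> topspace X. f x \<in> V}"
  proof (subst openin_subopen, intro ballI)
    fix x assume x: "x \<in> {x \<in> topspace X. f x \<in> V}"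
    then obtain e where e: "0 < e" "\<And>y. \<bar>y - f x\<bar> < e \<Longrightarrow> y \<in> V"
      using V unfolding open_dist dist_real_def by blast
    then obtain U where "openin X U" "x \<in> U" "\<forall>y\<in>U. \<bar>f y - f x\<bar> < e"
      using assms[of x e] x by blast
    then show "\<exists>T. openin X T \<and> x \<in> T \<and> T \<subseteq> {x \<in> topspace X. f x \<in> V}"
      using e(2) openin_subset by (intro exI[of _ U]) blast
  qed
qed simp

section \<open>A minimal flow that separates sets of indices\<close>

context minimal_G_space
begin

text \<open>
  Points of the flow are pairs \<open>(y, \<psi>)\<close>, where \<open>\<psi> (A, g)\<close> plays the role of the distance, measured by
  \<open>N\<close>, from \<open>g\<close> to the elements that carry \<open>y\<close> into \<open>\<Union>n\<in>A. T n\<close>.  The group acts on \<open>\<psi>\<close> by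
  right translation of \<open>g\<close>, which is jointly continuous because of the bound by \<open>N\<close>.
\<close>

lemma ex_separating_minimal_flow:
  fixes N :: "'b \<Rightarrow> real" and T :: "nat \<Rightarrow> 'a set"
  assumes N_add: "\<And>g h. N (g + h) \<le> N g + N h" and N_minus: "\<And>g. N (- g) = N g"
    and N_lim: "(N \<longlongrightarrow> 0) (nhds 0)" and N_nonneg: "\<And>g. 0 \<le> N g"
    and T: "\<And>n. openin X (T n)" "\<And>n. T n \<noteq> {}"
    and sep: "\<And>m n y u. m \<noteq> n \<Longrightarrow> y \<in> T m \<Longrightarrow> act u y \<in> T n \<Longrightarrow> 1 \<le> N u"
  obtains Z :: "('a \<times> (nat set \<times> 'b \<Rightarrow> real)) topology" and b :: "'b \<Rightarrow> _ \<Rightarrow> _" where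
    "minimal_G_space Z b" "\<And>n. \<exists>z\<in>topspace Z. fst z \<in> T n"
    "\<And>A. continuous_map Z euclideanreal (\<lambda>z. snd z (A, 0))"
    "\<And>z n A. z \<in> topspace Z \<Longrightarrow> fst z \<in> T n \<Longrightarrow> snd z (A, 0) = of_bool (n \<notin> A)"
proof -
  define P :: "('a \<times> (nat set \<times> 'b \<Rightarrow> real)) topology"
    where "P = prod_topology X (product_topology (\<lambda>_. top_of_set {0..1}) UNIV)"
  define b :: "'b \<Rightarrow> ('a \<times> (nat set \<times> 'b \<Rightarrow> real)) \<Rightarrow> ('a \<times> (nat set \<times> 'b \<Rightarrow> real))"
    where "b h z = (act h (fst z), \<lambda>(A, g). snd z (A, g + h))" for h z
  \<comment> \<open>\<open>Q1\<close> is the Lipschitz bound by \<open>N\<close>. \<open>Q2\<close>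
    prescribes 0 if \<open>n \<in> A\<close> and 1 otherwise, whenever \<open>g\<close> carries the
    first coordinate into \<open>T n\<close>. Quantified over all \<open>g\<close>, both conditions
    are invariant under right translation.\<close>
  define Q1 where "Q1 = (\<lambda>(A, u, g) (z :: 'a \<times> (nat set \<times> 'b \<Rightarrow> real)).
    \<bar>snd z (A, u + g) - snd z (A, g)\<bar> \<le> N u)"
  define Q2 where "Q2 = (\<lambda>(A, n, g) (z :: 'a \<times> (nat set \<times> 'b \<Rightarrow> real)).
    act g (fst z) \<in> T n \<longrightarrow> snd z (A, g) = of_bool (n \<notin> A))"
  define K where "K = {z \<in> topspace P. \<forall>i. Q1 i z} \<inter> {z \<in> topspace P. \<forall>i. Q2 i z}"
  have K_iff: "z \<in> K \<longleftrightarrow> fst z \<in> topspace X \<and> (\<forall>A g. 0 \<le> snd z (A, g) \<and> snd z (A, g) \<le> 1) \<and>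
    (\<forall>A u g. \<bar>snd z (A, u + g) - snd z (A, g)\<bar> \<le> N u) \<and>
    (\<forall>A n g. act g (fst z) \<in> T n \<longrightarrow> snd z (A, g) = of_bool (n \<notin> A))" for z
    by (cases z) (auto simp: K_def P_def Q1_def Q2_def PiE_iff)
  have cont_fst: "continuous_map P X fst"
    unfolding P_def by (rule continuous_map_fst)
  have cont_coord: "continuous_map P euclideanreal (\<lambda>z. snd z k)" for k
  proof -
    have "continuous_map P (top_of_set {0..1}) (\<lambda>z. snd z k)"
      unfolding P_def
      using continuous_map_compose[OF continuous_map_snd
        continuous_map_product_projection[of k UNIV "\<lambda>_. top_of_set {0..1::real}"]]
      by (simp add: o_def)
    then show ?thesis by (simp add: continuous_map_in_subtopology)
  qed
  have closed_all: "closedin P {z \<in> topspace P. \<forall>i. Q i z}"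
    if "\<And>i. closedin P {z \<in> topspace P. Q i z}" for Q :: "'i \<Rightarrow> _ \<Rightarrow> bool"
  proof -
    have "{z \<in> topspace P. \<forall>i. Q i z} = (\<Inter>i. {z \<in> topspace P. Q i z})" by auto
    then show ?thesis using that by (auto intro!: closedin_Inter)
  qed
  have "closedin P {z \<in> topspace P. Q1 i z}" for i
  proof -
    obtain A u g where i: "i = (A, u, g)" by (metis prod_cases3)
    have "continuous_map P euclideanreal (\<lambda>z. \<bar>snd z (A, u + g) - snd z (A, g)\<bar>)"
      by (intro continuous_map_real_abs continuous_map_diff cont_coord)
    from closedin_continuous_map_preimage[OF this, of "{..N u}"] show ?thesis
      by (simp add: Q1_def i)
  qed
  moreover have "closedin P {z \<in> topspace P. Q2 i z}" for i
  proof -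
    obtain A n g where i: "i = (A, n, g)" by (metis prod_cases3)
    \<comment> \<open>An implication from an open condition to a closed one is closed: it fails on
      the intersection of two open sets.\<close>
    have "openin P {z \<in> topspace P. act g (fst z) \<in> T n}"
      using openin_continuous_map_preimage[OF continuous_map_compose[OF cont_fst continuous_map_act] T(1)]
      by (simp add: o_def)
    moreover have "openin P {z \<in> topspace P. snd z (A, g) \<in> - {of_bool (n \<notin> A)}}"
      by (intro openin_continuous_map_preimage[OF cont_coord]) auto
    ultimately have "closedin P (topspace P - {z \<in> topspace P. act g (fst z) \<in> T n} \<inter>
        {z \<in> topspace P. snd z (A, g) \<in> - {of_bool (n \<notin> A)}})"
      by (intro closedin_diff openin_Int) auto
    moreover have "topspace P - {z \<in> topspace P. act g (fst z) \<in> T n} \<inter>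
        {z \<in> topspace P. snd z (A, g) \<in> - {of_bool (n \<notin> A)}} = {z \<in> topspace P. Q2 i z}"
      by (auto simp: Q2_def i)
    ultimately show ?thesis by simp
  qed
  ultimately have closedK: "closedin P K"
    unfolding K_def by (intro closedin_Int closed_all)
  have K_topspace: "topspace (subtopology P K) = K"
    using closedin_subset[OF closedK] by auto
  have bK: "b h z \<in> K" if "z \<in> K" for h z
    using that by (auto simp: K_iff b_def act_in_topspace add.assoc simp flip: act_add)
  interpret K: compact_G_space "subtopology P K" b
  proof
    have "compact_space P"
      unfolding P_def using compact
      by (auto simp: compact_space_prod_topology compact_space_product_topology compact_space_subtopology)
    then show "compact_space (subtopology P K)"
      using closedK by (simp add: closedin_compact_space compact_space_subtopology)
    have "Hausdorff_space P"
      unfolding P_def using Hausdorff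
      by (auto simp: Hausdorff_space_prod_topology Hausdorff_space_product_topology
          intro: Hausdorff_space_subtopology)
    then show "Hausdorff_space (subtopology P K)" by (rule Hausdorff_space_subtopology)
    let ?E = "prod_topology (euclidean :: 'b topology) (subtopology P K)"
    have topE: "topspace ?E = UNIV \<times> K" using K_topspace by simp
    have sub: "continuous_map ?E P snd"
      using continuous_map_snd[of euclidean "subtopology P K"] continuous_map_in_subtopology by blast
    have "continuous_map ?E (prod_topology (euclidean :: 'b topology) X) (\<lambda>p. (fst p, fst (snd p)))"
      using continuous_map_compose[OF sub cont_fst]
      by (intro continuous_map_pairedI continuous_map_fst) (simp_all add: o_def)
    from continuous_map_compose[OF this continuous_act]
    have cont1: "continuous_map ?E X (\<lambda>p. act (fst p) (fst (snd p)))" by (simp add: o_def)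
    have "continuous_map ?E euclideanreal (\<lambda>p. snd (snd p) (A, g + fst p))" for A g
    proof (rule continuous_map_realI)
      fix p and e :: real assume p: "p \<in> topspace ?E" and "0 < e"
      obtain h z where hz: "p = (h, z)" by (cases p)
      \<comment> \<open>Left addition of \<open>g + k - h - g\<close> carries \<open>g + h\<close>
        to \<open>g + k\<close>, and this element tends to 0 as \<open>k\<close> tends to
        \<open>h\<close>. Thus \<open>Q1\<close> bounds the effect of changing \<open>h\<close>,
        uniformly on \<open>K\<close>, while \<open>R\<close> below bounds the effect of changing
        \<open>z\<close>.\<close>
      have "((\<lambda>k. g + k - h - g) \<longlongrightarrow> g + h - h - g) (nhds h)"
        unfolding diff_conv_add_uminus by (intro tendsto_intros filterlim_ident)
      then have "filterlim (\<lambda>k. g + k - h - g) (nhds 0) (nhds h)" by simp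
      from filterlim_compose[OF N_lim this]
      have "\<forall>\<^sub>F k in nhds h. N (g + k - h - g) < e / 2"
        by (rule order_tendstoD(2)) (use \<open>0 < e\<close> in simp)
      then obtain H where H: "open H" "h \<in> H" "\<And>k. k \<in> H \<Longrightarrow> N (g + k - h - g) < e / 2"
        unfolding eventually_nhds by blast
      define R where "R = {z' \<in> topspace P. snd z' (A, g + h) \<in> ball (snd z (A, g + h)) (e / 2)}"
      have "openin P R"
        unfolding R_def by (intro openin_continuous_map_preimage[OF cont_coord]) auto
      then have "openin ?E (H \<times> (K \<inter> R))"
        using H(1) by (auto simp: openin_prod_Times_iff openin_subtopology)
      moreover have "p \<in> H \<times> (K \<inter> R)"
        using p H(2) \<open>0 < e\<close> hz closedin_subset[OF closedK] by (auto simp: R_def)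
      moreover have "\<bar>snd (snd q) (A, g + fst q) - snd (snd p) (A, g + fst p)\<bar> < e"
        if q: "q \<in> H \<times> (K \<inter> R)" for q
      proof -
        obtain k w where kw: "q = (k, w)" by (cases q)
        have "w \<in> K" using q kw by blast
        then have "\<bar>snd w (A, (g + k - h - g) + (g + h)) - snd w (A, g + h)\<bar> \<le> N (g + k - h - g)"
          unfolding K_iff by blast
        moreover have "(g + k - h - g) + (g + h) = g + k" by (simp add: add.assoc[symmetric])
        ultimately have "\<bar>snd w (A, g + k) - snd w (A, g + h)\<bar> \<le> N (g + k - h - g)" by metis
        moreover have "\<bar>snd w (A, g + h) - snd z (A, g + h)\<bar> < e / 2"
          using q kw by (auto simp: R_def dist_real_def abs_minus_commute)
        moreover have "N (g + k - h - g) < e / 2" using q kw H(3) by auto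
        ultimately have "\<bar>snd w (A, g + k) - snd z (A, g + h)\<bar> < e" by linarith
        then show ?thesis using hz kw by simp
      qed
      ultimately show "\<exists>U. openin ?E U \<and> p \<in> U \<and>
          (\<forall>q\<in>U. \<bar>snd (snd q) (A, g + fst q) - snd (snd p) (A, g + fst p)\<bar> < e)"
        by blast
    qed
    then have "continuous_map ?E (product_topology (\<lambda>_. top_of_set {0..1}) UNIV)
        (\<lambda>p. \<lambda>(A, g). snd (snd p) (A, g + fst p))"
      using topE by (auto simp: continuous_map_componentwise_UNIV continuous_map_in_subtopology K_iff)
    with cont1 have "continuous_map ?E P (\<lambda>(h, z). b h z)"
      unfolding P_def b_def case_prod_unfold by (intro continuous_map_pairedI) (simp_all add: case_prod_unfold)
    then show "continuous_map ?E (subtopology P K) (\<lambda>(h, z). b h z)"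
      using bK topE by (auto simp: continuous_map_in_subtopology)
    show "b 0 z = z" if "z \<in> topspace (subtopology P K)" for z
      using that K_topspace by (auto simp: b_def K_iff act_zero)
    show "b (g + h) z = b g (b h z)" if "z \<in> topspace (subtopology P K)" for g h z
      using that K_topspace by (auto simp: b_def K_iff act_add add.assoc)
  qed
  \<comment> \<open>The filter \<open>nhds 0\<close> sees the point 0 itself.\<close>
  have N0: "N 0 = 0"
  proof (rule ccontr)
    assume "N 0 \<noteq> 0"
    then have "\<forall>\<^sub>F g in nhds 0. dist (N g) 0 < N 0"
      using N_lim N_nonneg[of 0] by (intro tendstoD) auto
    then show False by (auto dest: eventually_nhds_x_imp_x simp: dist_real_def)
  qed
  obtain y0 where y0: "y0 \<in> topspace X" using nonempty by blast
  \<comment> \<open>The entry 1 truncates the distance at 1 and keeps the set nonempty, also for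
    empty \<open>A\<close>.\<close>
  define S where "S A y = insert 1 {N u | u. \<exists>n\<in>A. act u y \<in> T n}" for A y
  define F where "F A y = Inf (S A y)" for A y
  have S_nonneg: "0 \<le> x" if "x \<in> S A y" for x A y
    using that N_nonneg by (auto simp: S_def)
  have F_lower: "F A y \<le> x" if "x \<in> S A y" for x A y
    unfolding F_def using that S_nonneg by (intro cInf_lower bdd_belowI)
  have F_greatest: "c \<le> F A y" if "\<And>x. x \<in> S A y \<Longrightarrow> c \<le> x" for c A y
    unfolding F_def using that by (intro cInf_greatest) (auto simp: S_def)
  have F_act: "F A y \<le> F A (act u y) + N u" if y: "y \<in> topspace X" for A u y
  proof -
    have "F A y - N u \<le> x" if x: "x \<in> S A (act u y)" for x
    proof (cases "x = 1")
      case True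
      have "F A y \<le> 1" by (rule F_lower) (simp add: S_def)
      then show ?thesis using N_nonneg[of u] True by simp
    next
      case False
      then obtain v n where v: "x = N v" "n \<in> A" "act v (act u y) \<in> T n"
        using x by (auto simp: S_def)
      have "act (v + u) y \<in> T n" using v(3) by (simp add: act_add[OF y])
      then have "F A y \<le> N (v + u)" using v(2) by (intro F_lower) (auto simp: S_def)
      then show ?thesis using N_add[of v u] v(1) by simp
    qed
    then show ?thesis using F_greatest[of A "act u y" "F A y - N u"] by simp
  qed
  \<comment> \<open>The truncated distances along the orbit of \<open>y0\<close> form a point of
    \<open>K\<close>. For \<open>Q2\<close>, the identity gives distance \<open>N 0 = 0\<close> if
    \<open>n \<in> A\<close>; otherwise separation excludes every value below 1.\<close>
  have "(y0, \<lambda>(A, g). F A (act g y0)) \<in> K"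
    unfolding K_iff fst_conv snd_conv prod.case
  proof (intro conjI allI impI)
    show "y0 \<in> topspace X" by (rule y0)
    show "0 \<le> F A (act g y0)" for A g by (intro F_greatest S_nonneg)
    show "F A (act g y0) \<le> 1" for A g by (intro F_lower) (simp add: S_def)
    show "\<bar>F A (act (u + g) y0) - F A (act g y0)\<bar> \<le> N u" for A u g
      using F_act[OF act_in_topspace[OF y0], of A g u]
        F_act[OF act_in_topspace[OF act_in_topspace[OF y0]], of A u g "- u"]
      by (simp add: act_add y0 act_uminus_act act_in_topspace N_minus)
    show "F A (act g y0) = of_bool (n \<notin> A)" if n: "act g y0 \<in> T n" for A n g
    proof (cases "n \<in> A")
      case True
      have "act 0 (act g y0) \<in> T n" using n y0 by (simp add: act_zero act_in_topspace)
      then have "F A (act g y0) \<le> N 0" using True by (intro F_lower) (auto simp: S_def)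
      moreover have "0 \<le> F A (act g y0)" by (intro F_greatest S_nonneg)
      ultimately show ?thesis using True N0 by simp
    next
      case False
      have "1 \<le> N u" if "m \<in> A" "act u (act g y0) \<in> T m" for u m
        using sep[of n m, OF _ n that(2)] that(1) False by blast
      then have "1 \<le> F A (act g y0)" by (intro F_greatest) (auto simp: S_def)
      moreover have "F A (act g y0) \<le> 1" by (intro F_lower) (simp add: S_def)
      ultimately show ?thesis using False by simp
    qed
  qed
  then have "K \<noteq> {}" by blast
  then obtain Z where Z: "Z \<subseteq> K" "Z \<noteq> {}" "minimal_G_space (subtopology (subtopology P K) Z) b"
    using K.ex_minimal_subflow[of K] bK K_topspace by (metis closedin_topspace)
  let ?Z = "subtopology (subtopology P K) Z"
  interpret Z: minimal_G_space ?Z b by (rule Z(3))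
  have topZ: "topspace ?Z = Z"
    using Z(1) K_topspace by auto
  show thesis
  proof
    show "minimal_G_space ?Z b" by (rule Z(3))
    show "continuous_map ?Z euclideanreal (\<lambda>z. snd z (A, 0))" for A
      by (intro continuous_map_from_subtopology cont_coord)
    show "snd z (A, 0) = of_bool (n \<notin> A)" if "z \<in> topspace ?Z" "fst z \<in> T n" for z n A
    proof -
      have "z \<in> K" using that(1) topZ Z(1) by blast
      moreover from this have "act 0 (fst z) \<in> T n" using that(2) by (simp add: K_iff act_zero)
      ultimately show ?thesis unfolding K_iff by blast
    qed
    show "\<exists>z\<in>topspace ?Z. fst z \<in> T n" for n
    proof -
      obtain z where z: "z \<in> Z" using Z(2) by blast
      then have "fst z \<in> topspace X" using Z(1) K_iff by blast
      then obtain g where "act g (fst z) \<in> T n" using orbit_meets_open[OF _ T] by blast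
      moreover have "b g z \<in> topspace ?Z" using z topZ by (intro Z.act_in_topspace) simp
      ultimately show ?thesis by (intro bexI[of _ "b g z"]) (auto simp: b_def)
    qed
  qed
qed

end

text \<open>
  Otherwise there are infinitely many open sets that are pairwise separated by \<open>U\<close>.  Points of \<open>M\<close>
  above them have a convergent subsequence, and the flow just constructed tells every set of
  its terms from the complement; alternate terms give a contradiction.
\<close>

lemma universal_metrizable_locally_transitive:
  fixes M :: "'m topology"
    and act :: "'g::{topological_group_add, first_countable_topology} \<Rightarrow> 'm \<Rightarrow> 'm"
    and Y :: "'y topology" and act' :: "'g \<Rightarrow> 'y \<Rightarrow> 'y"
  assumes M: "universal_minimal_flow M act" "metrizable_space M"
    and Y: "minimal_G_space Y act'"
    and U: "open U" "0 \<in> U" and V: "openin Y V" "V \<noteq> {}"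
  shows "\<exists>W\<subseteq>V. openin Y W \<and> W \<noteq> {} \<and>
    (\<forall>W1 W2. openin Y W1 \<and> W1 \<subseteq> W \<and> W1 \<noteq> {} \<and> openin Y W2 \<and> W2 \<subseteq> W \<and> W2 \<noteq> {} \<longrightarrow>
      (\<exists>u\<in>U. \<exists>y\<in>W1. act' u y \<in> W2))"
proof (rule ccontr)
  assume contra: "\<not> ?thesis"
  interpret Y: minimal_G_space Y act' by (rule Y)
  \<comment> \<open>By assumption \<open>S n\<close> contains two nonempty open sets that
    \<open>U\<close> does not link. One is kept as \<open>T n\<close>; the other becomes
    \<open>S (Suc n)\<close> and contains all later \<open>T\<close>.\<close>
  have "\<exists>S. \<forall>n. (openin Y (S n) \<and> S n \<noteq> {} \<and> S n \<subseteq> V) \<and>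
      (\<exists>T. openin Y T \<and> T \<noteq> {} \<and> T \<subseteq> S n \<and> S (Suc n) \<subseteq> S n \<and>
        (\<forall>u\<in>U. \<forall>y\<in>T. act' u y \<notin> S (Suc n)))"
  proof (rule dependent_nat_choice)
    show "\<exists>S. openin Y S \<and> S \<noteq> {} \<and> S \<subseteq> V" using V by blast
    fix S and n :: nat
    assume "openin Y S \<and> S \<noteq> {} \<and> S \<subseteq> V"
    then have "\<exists>T S'. openin Y T \<and> T \<subseteq> S \<and> T \<noteq> {} \<and> openin Y S' \<and> S' \<subseteq> S \<and> S' \<noteq> {} \<and>
        (\<forall>u\<in>U. \<forall>y\<in>T. act' u y \<notin> S')"
      using contra by meson
    then show "\<exists>S'. (openin Y S' \<and> S' \<noteq> {} \<and> S' \<subseteq> V) \<and> (\<exists>T. openin Y T \<and> T \<noteq> {} \<and> T \<subseteq> S \<and>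
        S' \<subseteq> S \<and> (\<forall>u\<in>U. \<forall>y\<in>T. act' u y \<notin> S'))"
      using \<open>openin Y S \<and> S \<noteq> {} \<and> S \<subseteq> V\<close> by (meson order_trans)
  qed
  then obtain S T where S: "\<And>n. S (Suc n) \<subseteq> S n"
    and T: "\<And>n. openin Y (T n)" "\<And>n. T n \<noteq> {}" "\<And>n. T n \<subseteq> S n"
    and TS: "\<And>n u y. u \<in> U \<Longrightarrow> y \<in> T n \<Longrightarrow> act' u y \<notin> S (Suc n)"
    by metis
  obtain N where N: "\<And>g h. N (g + h) \<le> N g + N h" "\<And>g :: 'g. N (- g) = N g"
    "(N \<longlongrightarrow> 0) (nhds 0)" "\<And>g. 0 \<le> N g" "\<And>g. N g < (1 :: real) \<Longrightarrow> g \<in> U"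
    using group_gauge[OF U] by metis
  have sep_less: "1 \<le> N u" if "m < n" "y \<in> T m" "act' u y \<in> T n" for m n y u
  proof (rule ccontr)
    assume "\<not> 1 \<le> N u"
    then have "act' u y \<notin> S (Suc m)" using N(5) TS that(2) by simp
    moreover have "S n \<subseteq> S (Suc m)" using that(1) by (intro lift_Suc_antimono_le[of S, OF S]) simp
    ultimately show False using T(3) that(3) by blast
  qed
  \<comment> \<open>Passing from \<open>u\<close> to \<open>- u\<close> exchanges the roles of
    \<open>m\<close> and \<open>n\<close>, and \<open>N\<close> is symmetric.\<close>
  have sep: "1 \<le> N u" if "m \<noteq> n" "y \<in> T m" "act' u y \<in> T n" for m n y u
  proof (cases "m < n")
    case False
    have "y \<in> topspace Y" using that(2) openin_subset[OF T(1)] by blast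
    then have "act' (- u) (act' u y) \<in> T m" using that(2) by (simp add: Y.act_uminus_act)
    then show ?thesis using sep_less[of n m "act' u y" "- u"] False that N(2) by simp
  qed (use sep_less that in blast)
  obtain Z :: "('y \<times> (nat set \<times> 'g \<Rightarrow> real)) topology" and b :: "'g \<Rightarrow> _ \<Rightarrow> _" where
    Z: "minimal_G_space Z b" "\<And>n. \<exists>z\<in>topspace Z. fst z \<in> T n"
    "\<And>A. continuous_map Z euclideanreal (\<lambda>z. snd z (A, 0))"
    "\<And>z n A. z \<in> topspace Z \<Longrightarrow> fst z \<in> T n \<Longrightarrow> snd z (A, 0) = of_bool (n \<notin> A)"
    by (rule Y.ex_separating_minimal_flow[of N T, OF N(1-4) T(1,2)])
      (rule sep, assumption+, rule that, assumption+)
  obtain f where f: "continuous_map M Z f" "f ` topspace M = topspace Z"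
    using universal_minimal_flow_factor[OF M(1) Z(1)] unfolding is_factor_def by blast
  have "\<exists>p\<in>topspace M. fst (f p) \<in> T n" for n
  proof -
    obtain z where z: "z \<in> f ` topspace M" "fst z \<in> T n" using Z(2) f(2) by blast
    then show ?thesis by blast
  qed
  then obtain p where p: "\<And>n. p n \<in> topspace M" "\<And>n. fst (f (p n)) \<in> T n" by metis
  have "compact_space M"
    using M(1) unfolding universal_minimal_flow_def minimal_G_space_def compact_G_space_def by blast
  obtain r :: "nat \<Rightarrow> nat" and l where r: "strict_mono r" "limitin M (p \<circ> r) l sequentially"
  proof -
    obtain S d where S: "Metric_space S d" "M = Metric_space.mtopology S d"
      using M(2) unfolding metrizable_space_def by blast
    interpret Metric_space S d by (rule S(1))
    have "range p \<subseteq> S" using p(1) S(2) by auto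
    then show thesis using that \<open>compact_space M\<close> S(2) compact_space_sequentially by metis
  qed
  \<comment> \<open>Exactly the even-numbered terms of the subsequence have their index in
    \<open>A\<close>. The continuous coordinate at \<open>(A, 0)\<close> thus alternates between 0
    and 1 along a convergent sequence.\<close>
  define A where "A = range (\<lambda>i. r (2 * i))"
  have "continuous_map M euclideanreal (\<lambda>q. snd (f q) (A, 0))"
    using continuous_map_compose[OF f(1) Z(3)] by (simp add: o_def)
  from continuous_map_limit[OF this r(2)]
  have lim: "(\<lambda>i. snd (f (p (r i))) (A, 0)) \<longlonglongrightarrow> snd (f l) (A, 0)"
    by (simp add: o_def)
  have val: "snd (f (p (r i))) (A, 0) = of_bool (odd i)" for i
  proof -
    have "r i \<in> A \<longleftrightarrow> even i"
      using strict_mono_eq[OF r(1)] by (auto simp: A_def)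
    moreover have "f (p (r i)) \<in> topspace Z" using p(1) f(2) by blast
    ultimately show ?thesis using Z(4)[of "f (p (r i))" "r i" A] p(2) by simp
  qed
  have "strict_mono (\<lambda>i :: nat. 2 * i)" "strict_mono (\<lambda>i :: nat. 2 * i + 1)"
    by (simp_all add: strict_mono_def)
  from this[THEN LIMSEQ_subseq_LIMSEQ[OF lim]] show False
    by (simp add: o_def val LIMSEQ_const_iff)
qed

section \<open>Averaging over almost invariant finite sets\<close>

text \<open>The graph of \<open>f\<close> over \<open>Q\<close> is convex, so it contains the convex
  combinations of its points; the two coordinates of such a combination give the formula.\<close>

lemma affine_convex_sum:
  fixes f :: "'v::real_vector \<Rightarrow> 'w::real_vector"
  assumes "convex Q"
    and aff: "\<And>x y t. x \<in> Q \<Longrightarrow> y \<in> Q \<Longrightarrow> t \<in> {0..1} \<Longrightarrow>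
      f ((1 - t) *\<^sub>R x + t *\<^sub>R y) = (1 - t) *\<^sub>R f x + t *\<^sub>R f y"
    and "finite I" "(\<Sum>i\<in>I. a i) = 1" "\<And>i. i \<in> I \<Longrightarrow> 0 \<le> a i" "\<And>i. i \<in> I \<Longrightarrow> x i \<in> Q"
  shows "f (\<Sum>i\<in>I. a i *\<^sub>R x i) = (\<Sum>i\<in>I. a i *\<^sub>R f (x i))"
proof -
  have "convex ((\<lambda>x. (x, f x)) ` Q)"
    unfolding convex_alt
  proof (clarify, intro image_eqI)
    fix x y and t :: real
    assume xy: "x \<in> Q" "y \<in> Q" "0 \<le> t" "t \<le> 1"
    then show "(1 - t) *\<^sub>R (x, f x) + t *\<^sub>R (y, f y) =
        ((1 - t) *\<^sub>R x + t *\<^sub>R y, f ((1 - t) *\<^sub>R x + t *\<^sub>R y))"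
      using aff[of x y t] by simp
    show "(1 - t) *\<^sub>R x + t *\<^sub>R y \<in> Q"
      using \<open>convex Q\<close> xy by (simp add: convex_alt)
  qed
  then have "(\<Sum>i\<in>I. a i *\<^sub>R (x i, f (x i))) \<in> (\<lambda>x. (x, f x)) ` Q"
    using assms(3-6) by (intro convex_sum) auto
  then obtain q where "(\<Sum>i\<in>I. a i *\<^sub>R (x i, f (x i))) = (q, f q)" by blast
  then have "(\<Sum>i\<in>I. a i *\<^sub>R x i) = q" "(\<Sum>i\<in>I. a i *\<^sub>R f (x i)) = f q"
    by (auto dest: arg_cong[of _ _ fst] arg_cong[of _ _ snd] simp: fst_sum snd_sum)
  then show ?thesis by simp
qed

text \<open>
  Cover the flow by as few translates of \<open>W\<close> as possible.  Translating such a cover gives another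
  one, and minimality of the cardinality is exactly the marriage condition for matching
  the members of the two covers that meet.
\<close>

lemma (in minimal_G_space) ex_almost_invariant_finite_set:
  assumes W: "openin X W" "w \<in> W"
    and D: "\<And>x y g. x \<in> W \<Longrightarrow> y \<in> W \<Longrightarrow> D (act g x) (act g y)"
  obtains F :: "'b set" where "finite F" "F \<noteq> {}"
    "\<And>g. \<exists>r. bij_betw r F F \<and> (\<forall>h\<in>F. \<exists>z\<in>topspace X. D (act h w) z \<and> D z (act (g + r h) w))"
proof -
  define covers where "covers F \<longleftrightarrow> (\<forall>x\<in>topspace X. \<exists>h\<in>F. act (- h) x \<in> W)" for F
  have "\<exists>F. finite F \<and> covers F"
    using finite_translates_cover[OF W(1)] W(2) unfolding covers_def by (metis empty_iff)
  define n where "n = (LEAST n. \<exists>F. finite F \<and> covers F \<and> card F = n)"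
  obtain F where F: "finite F" "covers F" "card F = n"
    using LeastI_ex[of "\<lambda>n. \<exists>F. finite F \<and> covers F \<and> card F = n"] \<open>\<exists>F. finite F \<and> covers F\<close>
    unfolding n_def by blast
  have least: "card F \<le> card F'" if "finite F'" "covers F'" for F'
    unfolding F(3) n_def using that by (intro Least_le) blast
  have w: "w \<in> topspace X" using W openin_subset by blast
  have close: "D x y" if "act (- h) x \<in> W" "act (- h) y \<in> W" "x \<in> topspace X" "y \<in> topspace X" for h x y
    using D[OF that(1,2), of h] that(3,4) by (simp add: act_uminus_act)
  show thesis
  proof
    show "finite F" by (rule F)
    show "F \<noteq> {}" using F(2) nonempty by (auto simp: covers_def)
    fix g
    define A where "A h = {k \<in> F. \<exists>z\<in>topspace X. act (- h) z \<in> W \<and> act (- (g + k)) z \<in> W}" for h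
    have "\<exists>r. inj_on r F \<and> (\<forall>h\<in>F. r h \<in> A h)"
    proof (rule marriage)
      show "finite F" by (rule F)
      show "finite (A h)" for h using F(1) by (simp add: A_def)
      fix J assume J: "J \<subseteq> F"
      have finA: "finite (\<Union>h\<in>J. A h)"
        using F(1) by (rule rev_finite_subset) (auto simp: A_def)
      \<comment> \<open>A point in the translate by some \<open>h \<in> J\<close> also lies in one
        by some \<open>g + k\<close> with \<open>k \<in> F\<close>, and then
        \<open>k \<in> A h\<close>.\<close>
      have "covers ((F - J) \<union> (+) g ` (\<Union>h\<in>J. A h))"
        unfolding covers_def
      proof
        fix x assume x: "x \<in> topspace X"
        obtain h where h: "h \<in> F" "act (- h) x \<in> W" using F(2) x by (auto simp: covers_def)
        show "\<exists>k\<in>(F - J) \<union> (+) g ` (\<Union>h\<in>J. A h). act (- k) x \<in> W"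
        proof (cases "h \<in> J")
          case True
          obtain k where k: "k \<in> F" "act (- k) (act (- g) x) \<in> W"
            using F(2) act_in_topspace[OF x] by (auto simp: covers_def)
          then have "act (- (g + k)) x \<in> W"
            unfolding minus_add using act_add[OF x, of "- k" "- g"] by simp
          moreover from this have "k \<in> A h" using k(1) h(2) x by (auto simp: A_def)
          ultimately show ?thesis using True by blast
        qed (use h in blast)
      qed
      then have "card F \<le> card ((F - J) \<union> (+) g ` (\<Union>h\<in>J. A h))"
        using F(1) finA by (intro least) auto
      also have "\<dots> \<le> card (F - J) + card ((+) g ` (\<Union>h\<in>J. A h))" by (rule card_Un_le)
      also have "\<dots> \<le> (card F - card J) + card (\<Union>h\<in>J. A h)"
        using F(1) J finA by (intro add_mono card_image_le) (simp_all add: card_Diff_subset finite_subset)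
      finally show "card J \<le> card (\<Union>h\<in>J. A h)"
        using card_mono[OF F(1) J] by linarith
    qed
    then obtain r where r: "inj_on r F" "\<And>h. h \<in> F \<Longrightarrow> r h \<in> A h" by blast
    have "r ` F \<subseteq> F" using r(2) by (auto simp: A_def)
    then have "bij_betw r F F"
      using r(1) F(1) by (simp add: bij_betw_def endo_inj_surj)
    moreover have "\<exists>z\<in>topspace X. D (act h w) z \<and> D z (act (g + r h) w)" if h: "h \<in> F" for h
    proof -
      obtain z where z: "z \<in> topspace X" "act (- h) z \<in> W" "act (- (g + r h)) z \<in> W"
        using r(2)[OF h] by (auto simp: A_def)
      then show ?thesis
        using W(2) w
        by (intro bexI[of _ z] conjI close[of h] close[of "g + r h"])
          (auto simp: act_uminus_act act_in_topspace)
    qed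
    ultimately show "\<exists>r. bij_betw r F F \<and>
        (\<forall>h\<in>F. \<exists>z\<in>topspace X. D (act h w) z \<and> D z (act (g + r h) w))" by blast
  qed
qed

text \<open>Without a fixed point, each \<open>q\<close> has a \<open>g\<close> whose displacement
  \<open>act g x - x\<close> avoids a neighbourhood of 0 for all \<open>x\<close> near
  \<open>q\<close>. By compactness finitely many \<open>q\<close> suffice, and a convex
  neighbourhood inside the intersection of theirs contradicts \<open>almost\<close>.\<close>

lemma affine_compact_flow_fixed_point:
  fixes Q :: "'v::locally_convex_space set" and act :: "'g::topological_group_add \<Rightarrow> 'v \<Rightarrow> 'v"
  assumes Q: "affine_compact_flow Q act"
    and almost: "\<And>V. open V \<Longrightarrow> convex V \<Longrightarrow> 0 \<in> V \<Longrightarrow> \<exists>p\<in>Q. \<forall>g. act g p - p \<in> V"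
  shows "\<exists>q\<in>Q. \<forall>g. act g q = q"
proof (rule ccontr)
  assume contra: "\<not> ?thesis"
  have Q': "compact Q" "convex Q" "Q \<noteq> {}" "compact_G_space (top_of_set Q) act"
    using Q by (auto simp: affine_compact_flow_def)
  interpret compact_G_space "top_of_set Q" act by (rule Q'(4))
  have "\<exists>S V g. open S \<and> open V \<and> q \<in> S \<and> 0 \<in> V \<and> (\<forall>x\<in>Q \<inter> S. act g x - x \<notin> V)" if q: "q \<in> Q" for q
  proof -
    obtain g where g: "act g q - q \<noteq> 0" using contra q by auto
    obtain A V where AV: "open A" "open V" "act g q - q \<in> A" "0 \<in> V" "A \<inter> V = {}"
      using hausdorff[OF g] by blast
    have "continuous_on Q (\<lambda>x. act g x - x)"
      using continuous_map_act[of g] by (intro continuous_on_diff continuous_on_id) auto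
    then obtain S where S: "open S" "S \<inter> Q = (\<lambda>x. act g x - x) -` A \<inter> Q"
      using AV(1) unfolding continuous_on_open_invariant by blast
    have "q \<in> S" using S(2) AV(3) q by blast
    moreover have "act g x - x \<notin> V" if "x \<in> Q \<inter> S" for x using S(2) AV(5) that by blast
    ultimately show ?thesis using AV(2,4) S(1) by blast
  qed
  then obtain S V g where SVg: "\<And>q. q \<in> Q \<Longrightarrow> open (S q) \<and> open (V q) \<and> q \<in> S q \<and> 0 \<in> V q \<and>
      (\<forall>x\<in>Q \<inter> S q. act (g q) x - x \<notin> V q)"
    by metis
  obtain D where D: "D \<subseteq> Q" "finite D" "Q \<subseteq> \<Union> (S ` D)"
    using compactE_image[OF Q'(1), of Q S] SVg by blast
  have "open (\<Inter>q\<in>D. V q)" "0 \<in> (\<Inter>q\<in>D. V q)" using D SVg by auto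
  then obtain V' where V': "open V'" "convex V'" "0 \<in> V'" "V' \<subseteq> (\<Inter>q\<in>D. V q)"
    using locally_convex by blast
  then obtain p where p: "p \<in> Q" "\<And>g. act g p - p \<in> V'" using almost by blast
  then obtain q where "q \<in> D" "p \<in> S q" using D(3) by blast
  then show False using SVg p V'(4) D(1) by blast
qed

text \<open>Continuity of \<open>(a - b) + (c - d)\<close> at 0 yields an open \<open>B\<close> on
  which this expression stays in \<open>V\<close>. Every point of the closure of \<open>B\<close> is
  a difference of elements of \<open>B\<close>, so the closure serves as \<open>C\<close>.\<close>

lemma ex_closed_nhd_add:
  fixes V :: "'v::topological_ab_group_add set"
  assumes "open V" "0 \<in> V"
  obtains B C where "open B" "0 \<in> B" "closed C" "B \<subseteq> C" "\<And>x y. x \<in> C \<Longrightarrow> y \<in> C \<Longrightarrow> x + y \<in> V"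
proof -
  have "((\<lambda>p. (fst (fst p) - snd (fst p)) + (fst (snd p) - snd (snd p))) \<longlongrightarrow> (0 - 0) + (0 - 0 :: 'v))
      ((nhds 0 \<times>\<^sub>F nhds 0) \<times>\<^sub>F (nhds 0 \<times>\<^sub>F nhds 0))"
    by (intro tendsto_intros filterlim_compose[OF filterlim_fst filterlim_fst]
        filterlim_compose[OF filterlim_fst filterlim_snd] filterlim_compose[OF filterlim_snd filterlim_fst]
        filterlim_compose[OF filterlim_snd filterlim_snd])
  then have "\<forall>\<^sub>F p in (nhds 0 \<times>\<^sub>F nhds 0) \<times>\<^sub>F (nhds 0 \<times>\<^sub>F nhds 0).
      (fst (fst p) - snd (fst p)) + (fst (snd p) - snd (snd p)) \<in> V"
    using assms by (auto elim: topological_tendstoD)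
  then obtain P1 P2 P3 P4 where P: "eventually P1 (nhds (0 :: 'v))" "eventually P2 (nhds (0 :: 'v))"
    "eventually P3 (nhds (0 :: 'v))" "eventually P4 (nhds (0 :: 'v))"
    "\<And>a b c d. P1 a \<Longrightarrow> P2 b \<Longrightarrow> P3 c \<Longrightarrow> P4 d \<Longrightarrow> (a - b) + (c - d) \<in> V"
    unfolding eventually_prod_filter by fastforce
  have "\<forall>\<^sub>F x in nhds 0. P1 x \<and> P2 x \<and> P3 x \<and> P4 x"
    using P(1-4) by (intro eventually_conj)
  then obtain B where B: "open B" "0 \<in> B" "\<And>x. x \<in> B \<Longrightarrow> P1 x \<and> P2 x \<and> P3 x \<and> P4 x"
    unfolding eventually_nhds by blast
  have diff: "\<exists>a\<in>B. \<exists>b\<in>B. c = a - b" if "c \<in> closure B" for c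
  proof -
    \<comment> \<open>The neighbourhood \<open>c + B\<close> of \<open>c\<close> meets
      \<open>B\<close> in some \<open>a\<close>, and \<open>c = a - (a - c)\<close>.\<close>
    have "open ((\<lambda>x. x - c) -` B)"
      using B(1) by (intro open_vimage continuous_on_diff continuous_on_id continuous_on_const)
    moreover have "c \<in> (\<lambda>x. x - c) -` B" using B(2) by simp
    ultimately have "B \<inter> (\<lambda>x. x - c) -` B \<noteq> {}"
      using that open_Int_closure_eq_empty[of "(\<lambda>x. x - c) -` B" B] by blast
    then obtain a where "a \<in> B" "a - c \<in> B" by blast
    then show ?thesis by (intro bexI[of _ a] bexI[of _ "a - c"]) simp_all
  qed
  show thesis
  proof (rule that[of B "closure B"])
    show "B \<subseteq> closure B" by (rule closure_subset)
    show "x + y \<in> V" if xy: "x \<in> closure B" "y \<in> closure B" for x y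
    proof -
      obtain a b c d where "a \<in> B" "b \<in> B" "c \<in> B" "d \<in> B" "x = a - b" "y = c - d"
        using diff[OF xy(1)] diff[OF xy(2)] by blast
      then show ?thesis using P(5) B(3) by blast
    qed
  qed (use B in simp_all)
qed

section \<open>Almost fixed points in affine SUC flows\<close>

theorem proposition14p10:
  fixes M :: "'m topology"
    and act :: "'g::{topological_group_add, polish_space} \<Rightarrow> 'm \<Rightarrow> 'm"
  assumes "universal_minimal_flow M act"
    and "metrizable_space M"
  shows "SUC_amenable TYPE('g) TYPE('v::locally_convex_space)"
  unfolding SUC_amenable_def
proof (intro allI impI)
  fix Q :: "'v set" and a :: "'g \<Rightarrow> 'v \<Rightarrow> 'v"
  assume flow: "affine_compact_flow Q a" and SUC: "SUC (top_of_set Q) a"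
  have Q: "compact Q" "convex Q" "Q \<noteq> {}" "compact_G_space (top_of_set Q) a"
    using flow by (auto simp: affine_compact_flow_def)
  interpret Q: compact_G_space "top_of_set Q" a by (rule Q(4))
  have aQ: "a g x \<in> Q" if "x \<in> Q" for g x using Q.act_in_topspace that by simp
  obtain Y where Y: "Y \<subseteq> Q" "Y \<noteq> {}" "minimal_G_space (subtopology (top_of_set Q) Y) a"
    using Q.ex_minimal_subflow[of Q] Q(3) aQ by (metis closedin_subtopology_refl topspace_euclidean top_greatest)
  have top_Y: "subtopology (top_of_set Q) Y = top_of_set Y"
    using Y(1) by (simp add: subtopology_subtopology Int_absorb1)
  interpret Y: minimal_G_space "top_of_set Y" a using Y(3) unfolding top_Y .
  \<comment> \<open>This turns entourages into neighbourhoods of the diagonal, so that SUC applies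
    to conditions on differences.\<close>
  have uniformity: "uniformity_of (top_of_set Q) = diagonal_nhds (top_of_set Q)"
    unfolding uniformity_of_def
    using ex1_compatible_uniformity[OF Q.compact Q.Hausdorff]
      compatible_uniformity_diagonal_nhds[OF Q.compact Q.Hausdorff] by (rule the1_equality)
  have first_countable: "first_countable (euclidean :: 'g topology)"
    unfolding first_countable_def
  proof
    fix x :: 'g
    obtain A :: "nat \<Rightarrow> 'g set" where "\<And>i. x \<in> A i \<and> open (A i)"
      "\<And>S. open S \<Longrightarrow> x \<in> S \<Longrightarrow> \<exists>i. A i \<subseteq> S"
      using first_countable_basis[of x] by blast
    then show "\<exists>\<B>. countable \<B> \<and> (\<forall>V\<in>\<B>. openin euclidean V) \<and>
        (\<forall>U. openin euclidean U \<and> x \<in> U \<longrightarrow> (\<exists>V\<in>\<B>. x \<in> V \<and> V \<subseteq> U))"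
      by (intro exI[of _ "range A"]) auto
  qed
  show "\<exists>q\<in>Q. \<forall>g. a g q = q"
  proof (rule affine_compact_flow_fixed_point[OF flow])
    fix V :: "'v set" assume V: "open V" "convex V" "0 \<in> V"
    obtain B C where BC: "open B" "0 \<in> B" "closed C" "B \<subseteq> C" "\<And>x y. x \<in> C \<Longrightarrow> y \<in> C \<Longrightarrow> x + y \<in> V"
      using ex_closed_nhd_add[OF V(1,3)] by metis
    have cont: "continuous_map (prod_topology (top_of_set S) (top_of_set S)) euclidean (\<lambda>p. fst p - snd p)"
      for S :: "'v set"
    proof -
      have "continuous_on (S \<times> S) (\<lambda>p. fst p - snd p)"
        by (intro continuous_on_diff continuous_on_fst continuous_on_snd continuous_on_id)
      then show ?thesis by (simp add: subtopology_Times[symmetric])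
    qed
    \<comment> \<open>The entourage given by \<open>C\<close>: closed, as the Baire argument
      requires, and such that two successive steps in \<open>C\<close> add up to an element of
      \<open>V\<close>.\<close>
    define C' where "C' = {p \<in> Y \<times> Y. fst p - snd p \<in> C}"
    have C': "closedin (prod_topology (top_of_set Y) (top_of_set Y)) C'"
      using closedin_continuous_map_preimage[OF cont, of C Y] BC(3) by (simp add: C'_def)
    have SUC_C: "\<forall>\<^sub>F u in nhds 0. \<forall>g. (a (g + u) y, a g y) \<in> C'"
      if y: "y \<in> topspace (top_of_set Y)" for y
    proof -
      have "openin (prod_topology (top_of_set Q) (top_of_set Q)) {p \<in> Q \<times> Q. fst p - snd p \<in> B}"
        using openin_continuous_map_preimage[OF cont, of B Q] BC(1) by simp
      then have "eventually (\<lambda>p. fst p - snd p \<in> B) (uniformity_of (top_of_set Q))"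
        unfolding uniformity eventually_diagonal_nhds using BC(2)
        by (intro exI[of _ "{p \<in> Q \<times> Q. fst p - snd p \<in> B}"]) auto
      then have "\<forall>\<^sub>F u in nhds 0. \<forall>g. a (g + u) y - a g y \<in> B"
        using SUC y Y(1) unfolding SUC_def by fastforce
      then show ?thesis
        by (rule eventually_mono) (use Y.act_in_topspace y BC(4) in \<open>auto simp: C'_def\<close>)
    qed
    obtain W where W: "openin (top_of_set Y) W" "W \<noteq> {}"
      "\<And>x y g. x \<in> W \<Longrightarrow> y \<in> W \<Longrightarrow> (a g x, a g y) \<in> C'"
      by (rule Y.ex_open_uniformly_close[OF first_countable C' SUC_C
            universal_metrizable_locally_transitive[OF assms Y.minimal_G_space_axioms]]) (assumption | rule that)+
    obtain w where w: "w \<in> W" using W(2) by blast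
    obtain F where F: "finite F" "F \<noteq> {}" and match: "\<And>g. \<exists>r. bij_betw r F F \<and>
        (\<forall>h\<in>F. \<exists>z\<in>topspace (top_of_set Y). z - a h w \<in> C \<and> a (g + r h) w - z \<in> C)"
    proof (rule Y.ex_almost_invariant_finite_set[OF W(1) w, of "\<lambda>x y. y - x \<in> C"])
      show "a g y - a g x \<in> C" if "x \<in> W" "y \<in> W" for x y g
        using W(3)[OF that(2,1), of g] by (simp add: C'_def)
    qed (rule that)
    have wY: "w \<in> Y" using w openin_subset[OF W(1)] by auto
    then have "w \<in> Q" using Y(1) by blast
    define c where "c = 1 / real (card F)"
    have c: "(\<Sum>h\<in>F. c) = 1" "0 \<le> c" using F by (simp_all add: c_def)
    define p where "p = (\<Sum>h\<in>F. c *\<^sub>R a h w)"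
    have "p \<in> Q"
      unfolding p_def using F(1) Q(2) c aQ[OF \<open>w \<in> Q\<close>] by (intro convex_sum) auto
    moreover have "a g p - p \<in> V" for g
    proof -
      obtain r where r: "bij_betw r F F"
        "\<And>h. h \<in> F \<Longrightarrow> \<exists>z. z - a h w \<in> C \<and> a (g + r h) w - z \<in> C"
        using match[of g] by blast
      have "a g p = (\<Sum>h\<in>F. c *\<^sub>R a g (a h w))"
        unfolding p_def
      proof (rule affine_convex_sum[OF Q(2)])
        show "a g ((1 - t) *\<^sub>R x + t *\<^sub>R y) = (1 - t) *\<^sub>R a g x + t *\<^sub>R a g y"
          if "x \<in> Q" "y \<in> Q" "t \<in> {0..1}" for x y t
          using flow that by (simp add: affine_compact_flow_def)
      qed (use F(1) c aQ[OF \<open>w \<in> Q\<close>] in auto)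
      also have "\<dots> = (\<Sum>h\<in>F. c *\<^sub>R a (g + h) w)"
        using Y.act_add wY by simp
      \<comment> \<open>Reindexing by the permutation \<open>r\<close> pairs each
        \<open>a h w\<close> with the translate matched to it.\<close>
      also have "\<dots> = (\<Sum>h\<in>F. c *\<^sub>R a (g + r h) w)"
        using sum.reindex_bij_betw[OF r(1), of "\<lambda>h. c *\<^sub>R a (g + h) w"] by simp
      finally have "a g p - p = (\<Sum>h\<in>F. c *\<^sub>R (a (g + r h) w - a h w))"
        by (simp add: p_def sum_subtractf scaleR_diff_right)
      \<comment> \<open>The point \<open>z\<close> from the matching splits each displacement into
        two elements of \<open>C\<close>, so it lies in \<open>V\<close>; convexity of
        \<open>V\<close> handles the average.\<close>
      also have "\<dots> \<in> V"
      proof (rule convex_sum[OF F(1) V(2)])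
        fix h assume "h \<in> F"
        then obtain z where "z - a h w \<in> C" "a (g + r h) w - z \<in> C" using r(2) by blast
        from BC(5)[OF this] show "a (g + r h) w - a h w \<in> V" by simp
      qed (use c in auto)
      finally show ?thesis .
    qed
    ultimately show "\<exists>p\<in>Q. \<forall>g. a g p - p \<in> V" by blast
  qed
qed

end
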